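(* There exist constants $c>0$ and $\varepsilon_0>0$ such that for all integers $n\ge 2$ the $L^1$ transportation-cost mixing time of Kac's random walk on $SO(n)$ with respect to the Hilbert–Schmidt distance, $$\tau_{\mathrm{hs},1}(\varepsilon)=\inf\{t\in\mathbb{N}: W_{\mathrm{hs},1}(\mu K^t,\mathcal{H})\le\varepsilon \text{ for all Borel probability measures } \mu \text{ on } SO(n)\},$$ satisfies $$\tau_{\mathrm{hs},1}(\varepsilon_0)\ge c\,n^2 .$$
   Context: $\mathbb{N}=\{0,1,2,\dots\}$. $M(n,\mathbb{R})$ is the space of real $n\times n$ matrices, $a^\dagger$ is the transpose of $a$, and $SO(n)=\{a\in M(n,\mathbb{R}): aa^\dagger=\mathrm{id},\ \det a=1\}$. The metric $\mathrm{hs}$ on $SO(n)$ is $\mathrm{hs}(a,b)=\|a-b\|_{\mathrm{hs}}=\sqrt{\mathrm{Tr}((a-b)^\dagger(a-b))}$. $\mathcal{H}$ is the unique bi-invariant (Haar) Borel probability measure on $SO(n)$. For $1\le i<j\le n$ and $\theta\in[0,2\pi]$, $R(i,j,\theta)\in SO(n)$ is the linear map with $R(i,j,\theta)e_i=\cos\theta\, e_i+\sin\theta\, e_j$, $R(i,j,\theta)e_j=\cos\theta\, e_j-\sin\theta\, e_i$, and $R(i,j,\theta)e_k=e_k$ for $k\notin\{i,j\}$, where $e_1,\dots,e_n$ is the canonical basis of $\mathbb{R}^n$. The kernel of Kac's random walk is $$K_x(S)=\frac{1}{2\pi\binom{n}{2}}\sum_{1\le i<j\le n}\int_0^{2\pi}\delta_{R(i,j,\theta)x}(S)\,d\theta,\qquad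 x\in SO(n),\ S\subset SO(n)\text{ Borel}.$$ For a probability measure $\mu$, $\mu K(S)=\int K_x(S)\,d\mu(x)$, $\mu K^0=\mu$ and $\mu K^{t+1}=(\mu K^t)K$. For a metric space $(M,d)$ and Borel probability measures $\mu,\nu$ on $M$ with finite first moments, $W_{d,1}(\mu,\nu)=\inf\int d(x,y)\,d\eta(x,y)$, the infimum being over all couplings $\eta$ of $\mu$ and $\nu$ (probability measures on $M\times M$ with marginals $\mu,\nu$). *)

theory Defs
  imports
    "HOL-Probability.Probability"
    "Jordan_Normal_Form.Determinant"
begin

hide_const (open) Determinants.det Finite_Cartesian_Product.mat Finite_Cartesian_Product.vec
  Finite_Cartesian_Product.transpose Finite_Cartesian_Product.row Finite_Cartesian_Product.column

section \<open>The special orthogonal group with the Hilbert--Schmidt metric\<close>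

definition SO :: "nat \<Rightarrow> real mat set" where
  "SO n = {a \<in> carrier_mat n n. a * transpose_mat a = 1\<^sub>m n \<and> det a = 1}"

definition mat_trace :: "real mat \<Rightarrow> real" where
  "mat_trace a = (\<Sum>i<dim_row a. a $$ (i, i))"

definition hs :: "real mat \<Rightarrow> real mat \<Rightarrow> real" where
  "hs a b = sqrt (mat_trace (transpose_mat (a - b) * (a - b)))"

text \<open>Open sets are spelled out because \<^locale>\<open>Metric_space\<close> requires a distance that is
  symmetric on the whole type, and \<^const>\<open>hs\<close> is symmetric only on matrices of equal dimensions.
  See \<open>metric_borel_eq\<close> below.\<close>

definition metric_borel :: "'a set \<Rightarrow> ('a \<Rightarrow> 'a \<Rightarrow> real) \<Rightarrow> 'a measure" where
  "metric_borel M d = sigma M {U. U \<subseteq> M \<and> (\<forall>x\<in>U. \<exists>r>0. \<forall>y\<in>M. d x y < r \<longrightarrow> y \<in> U)}"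

abbreviation SO_borel :: "nat \<Rightarrow> real mat measure" where
  "SO_borel n \<equiv> metric_borel (SO n) hs"

definition borel_prob :: "nat \<Rightarrow> real mat measure \<Rightarrow> bool" where
  "borel_prob n \<mu> \<longleftrightarrow> prob_space \<mu> \<and> sets \<mu> = sets (SO_borel n)"

text \<open>There is exactly one such measure, so a statement about it may quantify over all \<open>H\<close>
  with \<open>is_haar n H\<close>.\<close>

definition is_haar :: "nat \<Rightarrow> real mat measure \<Rightarrow> bool" where
  "is_haar n H \<longleftrightarrow> borel_prob n H \<and>
     (\<forall>a \<in> SO n. \<forall>S \<in> sets (SO_borel n).
        emeasure H ((\<lambda>x. a * x) ` S) = emeasure H S \<and>
        emeasure H ((\<lambda>x. x * a) ` S) = emeasure H S)"

section \<open>Transportation cost\<close>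

text \<open>On a separable metric space the product \<open>\<sigma>\<close>-algebra is the Borel \<open>\<sigma>\<close>-algebra of the
  product space.\<close>

definition couplings :: "'a measure \<Rightarrow> 'a measure \<Rightarrow> ('a \<times> 'a) measure set" where
  "couplings \<mu> \<nu> = {\<eta>. prob_space \<eta> \<and> sets \<eta> = sets (\<mu> \<Otimes>\<^sub>M \<nu>) \<and>
     distr \<eta> \<mu> fst = \<mu> \<and> distr \<eta> \<nu> snd = \<nu>}"

definition W1 :: "('a \<Rightarrow> 'a \<Rightarrow> real) \<Rightarrow> 'a measure \<Rightarrow> 'a measure \<Rightarrow> ennreal" where
  "W1 d \<mu> \<nu> = (INF \<eta> \<in> couplings \<mu> \<nu>. \<integral>\<^sup>+ p. ennreal (d (fst p) (snd p)) \<partial>\<eta>)"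

section \<open>Kac's random walk\<close>

text \<open>Indices run over \<open>0, \<dots>, n - 1\<close>. Entry \<open>(k, l)\<close> is the \<open>k\<close>-th coordinate of the image
  of the \<open>l\<close>-th basis vector; cf. \<open>rot_unit_vec\<close> below.\<close>

definition rot :: "nat \<Rightarrow> nat \<Rightarrow> nat \<Rightarrow> real \<Rightarrow> real mat" where
  "rot n i j \<theta> = mat n n (\<lambda>(k, l).
     if k = i \<and> l = i then cos \<theta>
     else if k = j \<and> l = i then sin \<theta>
     else if k = j \<and> l = j then cos \<theta>
     else if k = i \<and> l = j then - sin \<theta>
     else if k = l then 1 else 0)"

definition kac_kernel :: "nat \<Rightarrow> real mat \<Rightarrow> real mat set \<Rightarrow> ennreal" where
  "kac_kernel n x S = ennreal (1 / (2 * pi * real (n choose 2))) *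
     (\<Sum>(i, j) \<in> {(i, j). i < j \<and> j < n}.
        \<integral>\<^sup>+ \<theta> \<in> {0..2 * pi}. indicator S (rot n i j \<theta> * x) \<partial>lborel)"

text \<open>The set function below is countably additive (see \<open>emeasure_kac_step\<close>), so
  \<^const>\<open>measure_of\<close> does return the measure with these values.\<close>

definition kac_step :: "nat \<Rightarrow> real mat measure \<Rightarrow> real mat measure" where
  "kac_step n \<mu> = measure_of (SO n) (sets (SO_borel n)) (\<lambda>S. \<integral>\<^sup>+ x. kac_kernel n x S \<partial>\<mu>)"

definition kac_walk :: "nat \<Rightarrow> real mat measure \<Rightarrow> nat \<Rightarrow> real mat measure" where
  "kac_walk n \<mu> t = (kac_step n ^^ t) \<mu>"

text \<open>The infimum is taken in \<^typ>\<open>enat\<close>, so it is \<open>\<infinity>\<close> when no such \<open>t\<close> exists.\<close>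

definition mixing_time :: "nat \<Rightarrow> real mat measure \<Rightarrow> real \<Rightarrow> enat" where
  "mixing_time n H \<epsilon> =
     Inf {enat t | t. \<forall>\<mu>. borel_prob n \<mu> \<longrightarrow> W1 hs (kac_walk n \<mu> t) H \<le> ennreal \<epsilon>}"

section \<open>Basic facts\<close>

lemma metric_borel_eq:
  assumes "Metric_space M d"
  shows "metric_borel M d = sigma M {U. openin (Metric_space.mtopology M d) U}"
proof -
  interpret Metric_space M d by fact
  have "(\<forall>x\<in>U. \<exists>r>0. \<forall>y\<in>M. d x y < r \<longrightarrow> y \<in> U) \<longleftrightarrow> (\<forall>x. x \<in> U \<longrightarrow> (\<exists>r>0. mball x r \<subseteq> U))"
    if "U \<subseteq> M" for U
  proof -
    have "(\<forall>y\<in>M. d x y < r \<longrightarrow> y \<in> U) \<longleftrightarrow> mball x r \<subseteq> U" if "x \<in> U" for x r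
      using \<open>U \<subseteq> M\<close> that by (auto simp: mball_def)
    then show ?thesis by (simp add: Ball_def)
  qed
  then show ?thesis
    unfolding metric_borel_def openin_mtopology
    by (intro arg_cong[where f = "sigma M"] Collect_cong conj_cong refl)
qed

lemma SO_carrier: "a \<in> SO n \<Longrightarrow> a \<in> carrier_mat n n"
  by (simp add: SO_def)

lemma hs_eq:
  assumes "a \<in> carrier_mat n n" "b \<in> carrier_mat n n"
  shows "hs a b = L2_set (\<lambda>(i, j). a $$ (i, j) - b $$ (i, j)) ({..<n} \<times> {..<n})"
proof -
  have "mat_trace (transpose_mat (a - b) * (a - b))
    = (\<Sum>j<n. \<Sum>i<n. (a $$ (i, j) - b $$ (i, j))\<^sup>2)"
    using assms
    by (auto simp: mat_trace_def scalar_prod_def power2_eq_square atLeast0LessThan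
        intro!: sum.cong)
  also have "\<dots> = (\<Sum>(i, j)\<in>{..<n} \<times> {..<n}. (a $$ (i, j) - b $$ (i, j))\<^sup>2)"
    by (subst sum.swap) (simp add: sum.cartesian_product)
  finally show ?thesis
    by (simp add: hs_def L2_set_def case_prod_unfold)
qed

lemma hs_nonneg: "0 \<le> hs a b"
proof -
  have "0 \<le> mat_trace (transpose_mat (a - b) * (a - b))"
    by (auto simp: mat_trace_def scalar_prod_def intro!: sum_nonneg)
  then show "0 \<le> hs a b" by (simp add: hs_def)
qed

lemma hs_eq_0_iff:
  assumes "a \<in> carrier_mat n n" "b \<in> carrier_mat n n"
  shows "hs a b = 0 \<longleftrightarrow> a = b"
  using assms by (auto simp: hs_eq[OF assms] L2_set_eq_0_iff intro!: eq_matI)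

lemma hs_commute:
  assumes "a \<in> carrier_mat n n" "b \<in> carrier_mat n n"
  shows "hs a b = hs b a"
  unfolding hs_eq[OF assms] hs_eq[OF assms(2,1)]
  by (simp add: L2_set_def case_prod_unfold power2_commute)

lemma hs_triangle:
  assumes "a \<in> carrier_mat n n" "b \<in> carrier_mat n n" "c \<in> carrier_mat n n"
  shows "hs a c \<le> hs a b + hs b c"
proof -
  have "hs a c = L2_set (\<lambda>p. (case p of (i, j) \<Rightarrow> a $$ (i, j) - b $$ (i, j))
      + (case p of (i, j) \<Rightarrow> b $$ (i, j) - c $$ (i, j))) ({..<n} \<times> {..<n})"
    by (simp add: hs_eq[OF assms(1,3)] case_prod_unfold)
  also have "\<dots> \<le> hs a b + hs b c"
    unfolding hs_eq[OF assms(1,2)] hs_eq[OF assms(2,3)] by (rule L2_set_triangle_ineq)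
  finally show ?thesis .
qed

lemma Metric_space_SO:
  "Metric_space (SO n) (\<lambda>a b. if a \<in> SO n \<and> b \<in> SO n then hs a b else 0)"
  by standard
    (auto simp: hs_nonneg hs_eq_0_iff[OF SO_carrier SO_carrier]
      intro: hs_commute[OF SO_carrier SO_carrier] hs_triangle[OF SO_carrier SO_carrier SO_carrier])

lemma space_SO_borel [simp]: "space (SO_borel n) = SO n"
  unfolding metric_borel_def by (rule space_measure_of) auto

lemma sets_SO_borel:
  "sets (SO_borel n) =
    sigma_sets (SO n) {U. U \<subseteq> SO n \<and> (\<forall>x\<in>U. \<exists>r>0. \<forall>y\<in>SO n. hs x y < r \<longrightarrow> y \<in> U)}"
  unfolding metric_borel_def by (rule sets_measure_of) auto

lemma measurable_entry:
  assumes "i < n" "j < n"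
  shows "(\<lambda>a. a $$ (i, j)) \<in> borel_measurable (SO_borel n)"
proof (rule borel_measurableI)
  fix V :: "real set" assume V: "open V"
  have "\<exists>r>0. \<forall>y\<in>SO n. hs x y < r \<longrightarrow> y $$ (i, j) \<in> V"
    if x: "x \<in> SO n" "x $$ (i, j) \<in> V" for x
  proof -
    from V x(2) obtain r where r: "r > 0" "\<And>z. dist z (x $$ (i, j)) < r \<Longrightarrow> z \<in> V"
      unfolding open_dist by blast
    have "y $$ (i, j) \<in> V" if y: "y \<in> SO n" "hs x y < r" for y
    proof -
      have "\<bar>x $$ (i, j) - y $$ (i, j)\<bar> \<le> hs x y"
        unfolding hs_eq[OF SO_carrier[OF x(1)] SO_carrier[OF y(1)]]
        using assms member_le_L2_set[of "{..<n} \<times> {..<n}" "(i, j)"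
            "\<lambda>p. \<bar>case p of (i, j) \<Rightarrow> x $$ (i, j) - y $$ (i, j)\<bar>"]
        by (simp add: L2_set_def)
      with y(2) show ?thesis by (intro r(2)) (simp add: dist_real_def abs_minus_commute)
    qed
    with r(1) show ?thesis by blast
  qed
  then show "(\<lambda>a. a $$ (i, j)) -` V \<inter> space (SO_borel n) \<in> sets (SO_borel n)"
    unfolding sets_SO_borel space_SO_borel by (intro sigma_sets.Basic) auto
qed

lemma measurable_SO_borelI:
  assumes sp: "\<And>x. x \<in> space N \<Longrightarrow> f x \<in> SO n"
    and en: "\<And>i j. i < n \<Longrightarrow> j < n \<Longrightarrow> (\<lambda>x. f x $$ (i, j)) \<in> borel_measurable N"
  shows "f \<in> measurable N (SO_borel n)"
  unfolding metric_borel_def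
proof (rule measurable_measure_of)
  show "f \<in> space N \<rightarrow> SO n" using sp by auto
  fix U assume "U \<in> {U. U \<subseteq> SO n \<and> (\<forall>x\<in>U. \<exists>r>0. \<forall>y\<in>SO n. hs x y < r \<longrightarrow> y \<in> U)}"
  then have U: "U \<subseteq> SO n" "\<forall>x\<in>U. \<exists>r>0. \<forall>y\<in>SO n. hs x y < r \<longrightarrow> y \<in> U" by auto
  from bchoice[OF U(2)] obtain r where
    r: "\<And>x. x \<in> U \<Longrightarrow> r x > (0::real)" "\<And>x y. x \<in> U \<Longrightarrow> y \<in> SO n \<Longrightarrow> hs x y < r x \<Longrightarrow> y \<in> U"
    by blast
  define h :: "real mat \<Rightarrow> nat \<Rightarrow> nat \<Rightarrow> real"
    where "h a = (\<lambda>i j. if i < n \<and> j < n then a $$ (i, j) else 0)" for a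
  define dd :: "real mat \<Rightarrow> (nat \<Rightarrow> nat \<Rightarrow> real) \<Rightarrow> real"
    where "dd a g = sqrt (\<Sum>p\<in>{..<n} \<times> {..<n}. (a $$ p - g (fst p) (snd p))\<^sup>2)" for a g
  define V where "V = (\<Union>a\<in>U. {g. dd a g < r a})"
  have co: "continuous_on UNIV (\<lambda>g :: nat \<Rightarrow> nat \<Rightarrow> real. g i j)" for i j
    by (rule continuous_on_product_then_coordinatewise[OF continuous_on_product_coordinates])
  have "continuous_on UNIV (dd a)" for a
    unfolding dd_def
    by (intro continuous_on_real_sqrt continuous_on_sum continuous_on_power continuous_on_diff
        continuous_on_const co)
  then have "open V"
    unfolding V_def by (intro open_UN ballI open_Collect_less continuous_on_const)
  have hd: "dd a (h b) = hs a b" if "a \<in> SO n" "b \<in> SO n" for a b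
    unfolding hs_eq[OF SO_carrier[OF that(1)] SO_carrier[OF that(2)]] dd_def h_def L2_set_def
    by (intro arg_cong[where f = sqrt] sum.cong) auto
  have "f x \<in> U \<longleftrightarrow> h (f x) \<in> V" if x: "x \<in> space N" for x
  proof
    assume U: "f x \<in> U"
    have "dd (f x) (h (f x)) < r (f x)"
      using r(1)[OF U] hd[OF sp sp, OF x x] hs_eq_0_iff[OF SO_carrier SO_carrier, OF sp sp, OF x x]
      by simp
    with U show "h (f x) \<in> V" unfolding V_def by blast
  next
    assume "h (f x) \<in> V"
    then obtain a where a: "a \<in> U" "dd a (h (f x)) < r a" unfolding V_def by blast
    then have "hs a (f x) < r a" using hd[OF subsetD[OF U(1) a(1)] sp[OF x]] by simp
    then show "f x \<in> U" by (rule r(2)[OF a(1) sp[OF x]])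
  qed
  then have "f -` U \<inter> space N = (\<lambda>x. h (f x)) -` V \<inter> space N" by blast
  moreover have "(\<lambda>x. h (f x)) \<in> borel_measurable N"
  proof (intro measurable_coordinatewise_then_product)
    fix i j
    show "(\<lambda>x. h (f x) i j) \<in> borel_measurable N"
      using en by (cases "i < n \<and> j < n") (auto simp: h_def)
  qed
  ultimately show "f -` U \<inter> space N \<in> sets N"
    using \<open>open V\<close> by (simp add: measurable_sets_borel borel_open)
qed auto

lemma rot_carrier [simp]: "rot n i j \<theta> \<in> carrier_mat n n"
  by (simp add: rot_def)

lemma rot_unit_vec:
  assumes "i < j" "j < n"
  shows "rot n i j \<theta> *\<^sub>v unit_vec n i = cos \<theta> \<cdot>\<^sub>v unit_vec n i + sin \<theta> \<cdot>\<^sub>v unit_vec n j"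
    and "rot n i j \<theta> *\<^sub>v unit_vec n j = cos \<theta> \<cdot>\<^sub>v unit_vec n j - sin \<theta> \<cdot>\<^sub>v unit_vec n i"
    and "k < n \<Longrightarrow> k \<noteq> i \<Longrightarrow> k \<noteq> j \<Longrightarrow> rot n i j \<theta> *\<^sub>v unit_vec n k = unit_vec n k"
proof -
  have *: "vec_index (rot n i j \<theta> *\<^sub>v unit_vec n l) m = rot n i j \<theta> $$ (m, l)"
    if "m < n" "l < n" for m l
    using that carrier_matD[OF rot_carrier[of n i j \<theta>]] by simp
  have d: "dim_vec (rot n i j \<theta> *\<^sub>v unit_vec n l) = n" for l
    using carrier_matD[OF rot_carrier[of n i j \<theta>]] by simp
  have e: "vec_index (unit_vec n l :: real vec) m = (if m = l then 1 else 0)" if "m < n" "l < n" for m l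
    using that by simp
  show "rot n i j \<theta> *\<^sub>v unit_vec n i = cos \<theta> \<cdot>\<^sub>v unit_vec n i + sin \<theta> \<cdot>\<^sub>v unit_vec n j"
    using assms by (intro eq_vecI) (simp_all add: * d e rot_def)
  show "rot n i j \<theta> *\<^sub>v unit_vec n j = cos \<theta> \<cdot>\<^sub>v unit_vec n j - sin \<theta> \<cdot>\<^sub>v unit_vec n i"
    using assms by (intro eq_vecI) (simp_all add: * d e rot_def)
  show "rot n i j \<theta> *\<^sub>v unit_vec n k = unit_vec n k" if "k < n" "k \<noteq> i" "k \<noteq> j"
    using that by (intro eq_vecI) (simp_all add: * d e rot_def)
qed

lemma rot_mult:
  assumes "i < j" "j < n"
  shows "rot n i j \<theta> * rot n i j \<phi> = rot n i j (\<theta> + \<phi>)"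
proof (rule eq_matI)
  fix k l assume "k < dim_row (rot n i j (\<theta> + \<phi>))" "l < dim_col (rot n i j (\<theta> + \<phi>))"
  then have kl: "k < n" "l < n" by (simp_all add: rot_def)
  let ?f = "\<lambda>m. rot n i j \<theta> $$ (k, m) * rot n i j \<phi> $$ (m, l)"
  have "(rot n i j \<theta> * rot n i j \<phi>) $$ (k, l) = (\<Sum>m\<in>{..<n}. ?f m)"
    using kl by (simp add: rot_def scalar_prod_def atLeast0LessThan)
  also have "\<dots> = (\<Sum>m\<in>(if k = i \<or> k = j then {i, j} else {k}). ?f m)"
    using assms kl by (intro sum.mono_neutral_right) (auto simp: rot_def)
  also have "\<dots> = rot n i j (\<theta> + \<phi>) $$ (k, l)"
    using assms kl by (auto simp: rot_def cos_add sin_add)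
  finally show "(rot n i j \<theta> * rot n i j \<phi>) $$ (k, l) = rot n i j (\<theta> + \<phi>) $$ (k, l)" .
qed (simp_all add: rot_def)

lemma rot_in_SO:
  assumes "i < j" "j < n"
  shows "rot n i j \<theta> \<in> SO n"
proof -
  have T: "transpose_mat (rot n i j \<phi>) = rot n i j (- \<phi>)" for \<phi>
    using assms by (auto simp: rot_def intro!: eq_matI)
  have Z: "rot n i j 0 = 1\<^sub>m n"
  proof (rule eq_matI)
    fix k l assume "k < dim_row (1\<^sub>m n :: real mat)" "l < dim_col (1\<^sub>m n :: real mat)"
    then show "rot n i j 0 $$ (k, l) = 1\<^sub>m n $$ (k, l)"
      using assms by (cases "k = i"; cases "k = j"; cases "l = i"; cases "l = j") (simp_all add: rot_def)
  qed (simp_all add: rot_def)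
  have orth: "rot n i j \<phi> * transpose_mat (rot n i j \<phi>) = 1\<^sub>m n" for \<phi>
    unfolding T rot_mult[OF assms] add.right_inverse Z ..
  have "det (rot n i j \<phi>) * det (rot n i j \<phi>) = 1" for \<phi>
    using arg_cong[OF orth[of \<phi>], of det]
    by (simp add: det_mult[of _ n] det_transpose[of _ n])
  moreover have "det (rot n i j \<theta>) = det (rot n i j (\<theta> / 2)) * det (rot n i j (\<theta> / 2))"
    using det_mult[OF rot_carrier rot_carrier, of n i j "\<theta> / 2" i j "\<theta> / 2"]
    by (simp add: rot_mult[OF assms])
  ultimately show ?thesis by (simp add: SO_def orth)
qed

lemma SO_mult:
  assumes "a \<in> SO n" "b \<in> SO n"
  shows "a * b \<in> SO n"
proof -
  note c = SO_carrier[OF assms(1)] SO_carrier[OF assms(2)]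
  have "(a * b) * transpose_mat (a * b) = a * (b * transpose_mat b) * transpose_mat a"
    using c by (simp add: transpose_mult[OF c] assoc_mult_mat[of _ n n _ n _ n])
  also have "b * transpose_mat b = 1\<^sub>m n" using assms(2) by (simp add: SO_def)
  also have "a * 1\<^sub>m n = a" using c(1) by simp
  also have "a * transpose_mat a = 1\<^sub>m n" using assms(1) by (simp add: SO_def)
  finally have "(a * b) * transpose_mat (a * b) = 1\<^sub>m n" .
  moreover have "det a = 1" "det b = 1" using assms by (simp_all add: SO_def)
  then have "det (a * b) = 1" by (simp add: det_mult[OF c])
  ultimately show ?thesis using mult_carrier_mat[OF c] by (simp add: SO_def)
qed

lemma measurable_rot_mult:
  assumes "i < j" "j < n"
  shows "(\<lambda>(x, \<theta>). rot n i j \<theta> * x) \<in> measurable (SO_borel n \<Otimes>\<^sub>M lborel) (SO_borel n)"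
proof (rule measurable_SO_borelI)
  fix p assume "p \<in> space (SO_borel n \<Otimes>\<^sub>M (lborel :: real measure))"
  then show "(case p of (x, \<theta>) \<Rightarrow> rot n i j \<theta> * x) \<in> SO n"
    by (auto simp: space_pair_measure intro!: SO_mult rot_in_SO assms)
next
  fix k l assume kl: "k < n" "l < n"
  let ?P = "SO_borel n \<Otimes>\<^sub>M (lborel :: real measure)"
  have "(\<lambda>p. \<Sum>m<n. rot n i j (snd p) $$ (k, m) * fst p $$ (m, l)) \<in> borel_measurable ?P"
  proof (intro borel_measurable_sum borel_measurable_times)
    fix m assume "m \<in> {..<n}"
    then have m: "m < n" by simp
    show "(\<lambda>p. rot n i j (snd p) $$ (k, m)) \<in> borel_measurable ?P"
      using kl m by (auto simp: rot_def)
    show "(\<lambda>p. fst p $$ (m, l)) \<in> borel_measurable ?P"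
      by (rule measurable_compose[OF measurable_fst measurable_entry[OF m kl(2)]])
  qed
  also have "?this \<longleftrightarrow> (\<lambda>p. (case p of (x, \<theta>) \<Rightarrow> rot n i j \<theta> * x) $$ (k, l)) \<in> borel_measurable ?P"
    using kl SO_carrier
    by (intro measurable_cong)
      (force simp: space_pair_measure rot_def scalar_prod_def atLeast0LessThan
        intro!: sum.cong dest!: SO_carrier)
  finally show "(\<lambda>p. (case p of (x, \<theta>) \<Rightarrow> rot n i j \<theta> * x) $$ (k, l)) \<in> borel_measurable ?P" .
qed

lemma measurable_kac_integrand:
  assumes "i < j" "j < n" "S \<in> sets (SO_borel n)"
  shows "(\<lambda>p. indicator S (rot n i j (snd p) * fst p) * indicator {0..2 * pi} (snd p) :: ennreal)
    \<in> borel_measurable (SO_borel n \<Otimes>\<^sub>M lborel)"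
proof -
  have "(\<lambda>p. indicator S (rot n i j (snd p) * fst p) :: ennreal)
      \<in> borel_measurable (SO_borel n \<Otimes>\<^sub>M lborel)"
    using measurable_compose[OF measurable_rot_mult[OF assms(1,2)]
        borel_measurable_indicator[OF assms(3)]]
    by (simp add: case_prod_unfold)
  then show ?thesis by measurable
qed

lemma measurable_kac_kernel:
  assumes "S \<in> sets (SO_borel n)"
  shows "(\<lambda>x. kac_kernel n x S) \<in> borel_measurable (SO_borel n)"
  unfolding kac_kernel_def case_prod_unfold
  by (intro borel_measurable_times_ennreal borel_measurable_const borel_measurable_sum
      lborel.borel_measurable_nn_integral)
    (use measurable_kac_integrand[OF _ _ assms] in \<open>auto simp: case_prod_unfold\<close>)

lemma kac_kernel_suminf:
  assumes "x \<in> SO n" "range A \<subseteq> sets (SO_borel n)" "disjoint_family A"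
  shows "(\<Sum>m. kac_kernel n x (A m)) = kac_kernel n x (\<Union>m. A m)"
proof -
  have "(\<Sum>m. \<integral>\<^sup>+ \<theta>\<in>{0..2 * pi}. indicator (A m) (rot n i j \<theta> * x) \<partial>lborel)
      = (\<integral>\<^sup>+ \<theta>\<in>{0..2 * pi}. indicator (\<Union>m. A m) (rot n i j \<theta> * x) \<partial>lborel)"
    if ij: "i < j" "j < n" for i j
  proof -
    have "(\<lambda>\<theta>. indicator (A m) (rot n i j \<theta> * x) * indicator {0..2 * pi} \<theta> :: ennreal)
        \<in> borel_measurable lborel" for m
      using measurable_compose[OF measurable_Pair1'[of x "SO_borel n" lborel]
          measurable_kac_integrand[OF ij, of "A m"]] assms(1,2)
      by (auto simp: range_subsetD)
    then show ?thesis
      by (simp add: nn_integral_suminf[symmetric] suminf_indicator[OF assms(3), symmetric])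
  qed
  then show ?thesis
    unfolding kac_kernel_def ennreal_suminf_cmult case_prod_unfold
    by (subst suminf_sum) (auto intro!: sum.cong arg_cong2[where f = "(*)"])
qed

lemma card_pairs: "card {(i, j). i < j \<and> j < n} = n choose 2"
proof -
  have "{(i, j). i < j \<and> j < n} = (SIGMA j:{..<n}. {..<j})\<inverse>" by auto
  then have "card {(i, j). i < j \<and> j < n} = (\<Sum>j<n. j)" by simp
  also have "\<dots> = n choose 2"
    by (induction n) (simp_all add: numeral_2_eq_2)
  finally show ?thesis .
qed

lemma kac_kernel_SO:
  assumes "n \<ge> 2" "x \<in> SO n"
  shows "kac_kernel n x (SO n) = 1"
proof -
  have "(\<integral>\<^sup>+ \<theta>\<in>{0..2 * pi}. indicator (SO n) (rot n i j \<theta> * x) \<partial>lborel) = ennreal (2 * pi)"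
    if "i < j" "j < n" for i j
    using SO_mult[OF rot_in_SO[OF that] assms(2)] by simp
  then have "kac_kernel n x (SO n)
      = ennreal (1 / (2 * pi * real (n choose 2))) * (\<Sum>p\<in>{(i, j). i < j \<and> j < n}. ennreal (2 * pi))"
    unfolding kac_kernel_def
    by (intro arg_cong2[where f = "(*)"] sum.cong refl) auto
  also have "\<dots> = ennreal (1 / (2 * pi * real (n choose 2)) * (real (n choose 2) * (2 * pi)))"
    unfolding sum_constant card_pairs ennreal_of_nat_eq_real_of_nat
    by (subst ennreal_mult'[symmetric], simp, subst ennreal_mult'[symmetric]) simp_all
  also have "\<dots> = 1"
    using assms(1) by (simp add: binomial_eq_0_iff)
  finally show ?thesis .
qed

lemma sets_kac_step [simp]: "sets (kac_step n \<mu>) = sets (SO_borel n)"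
  unfolding kac_step_def
  by (metis sets.sets_measure_of_eq space_SO_borel)

lemma emeasure_kac_step:
  assumes "sets \<mu> = sets (SO_borel n)" "S \<in> sets (SO_borel n)"
  shows "emeasure (kac_step n \<mu>) S = (\<integral>\<^sup>+ x. kac_kernel n x S \<partial>\<mu>)"
proof (rule emeasure_measure_of[OF kac_step_def])
  have sp: "space \<mu> = SO n" using sets_eq_imp_space_eq[OF assms(1)] by simp
  show "sets (SO_borel n) \<subseteq> Pow (SO n)" using sets.space_closed[of "SO_borel n"] by simp
  show "S \<in> sets (kac_step n \<mu>)" using assms(2) by simp
  show "positive (sets (kac_step n \<mu>)) (\<lambda>S. \<integral>\<^sup>+ x. kac_kernel n x S \<partial>\<mu>)"
    by (simp add: positive_def kac_kernel_def)
  show "countably_additive (sets (kac_step n \<mu>)) (\<lambda>S. \<integral>\<^sup>+ x. kac_kernel n x S \<partial>\<mu>)"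
  proof (rule countably_additiveI)
    fix A :: "nat \<Rightarrow> real mat set"
    assume A: "range A \<subseteq> sets (kac_step n \<mu>)" "disjoint_family A"
    have "(\<lambda>x. kac_kernel n x (A m)) \<in> borel_measurable \<mu>" for m
      using measurable_kac_kernel[of "A m" n] A(1)
      by (simp add: range_subsetD cong: measurable_cong_sets[OF assms(1) refl])
    then have "(\<Sum>m. \<integral>\<^sup>+ x. kac_kernel n x (A m) \<partial>\<mu>) = (\<integral>\<^sup>+ x. (\<Sum>m. kac_kernel n x (A m)) \<partial>\<mu>)"
      by (simp add: nn_integral_suminf)
    also have "\<dots> = (\<integral>\<^sup>+ x. kac_kernel n x (\<Union>m. A m) \<partial>\<mu>)"
      using A by (intro nn_integral_cong kac_kernel_suminf) (auto simp: sp)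
    finally show "(\<Sum>m. \<integral>\<^sup>+ x. kac_kernel n x (A m) \<partial>\<mu>) = (\<integral>\<^sup>+ x. kac_kernel n x (\<Union>m. A m) \<partial>\<mu>)" .
  qed
qed

lemma borel_prob_kac_walk:
  assumes "n \<ge> 2" "borel_prob n \<mu>"
  shows "borel_prob n (kac_walk n \<mu> t)"
proof -
  have "borel_prob n (kac_step n \<nu>)" if \<nu>: "borel_prob n \<nu>" for \<nu>
  proof -
    from \<nu> interpret prob_space \<nu> by (simp add: borel_prob_def)
    have sets: "sets \<nu> = sets (SO_borel n)" using \<nu> by (simp add: borel_prob_def)
    have sp: "space \<nu> = SO n" using sets_eq_imp_space_eq[OF sets] by simp
    have sp': "space (kac_step n \<nu>) = SO n" using sets_eq_imp_space_eq[OF sets_kac_step] by simp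
    have "SO n \<in> sets (SO_borel n)" using sets.top[of "SO_borel n"] by simp
    then have "emeasure (kac_step n \<nu>) (SO n) = (\<integral>\<^sup>+ x. kac_kernel n x (SO n) \<partial>\<nu>)"
      by (rule emeasure_kac_step[OF sets])
    also have "\<dots> = (\<integral>\<^sup>+ x. 1 \<partial>\<nu>)"
      by (intro nn_integral_cong kac_kernel_SO assms(1)) (simp add: sp)
    also have "\<dots> = 1" by (simp add: emeasure_space_1)
    finally show ?thesis by (simp add: borel_prob_def sp' prob_spaceI)
  qed
  then show ?thesis
    using assms(2) by (induction t) (simp_all add: kac_walk_def)
qed

end

theory Submission
  imports Defs
begin

text \<open>
  The proof compares entropies at a constant Hilbert--Schmidt scale \<open>\<rho>\<close>. Discretising the angles
  shows that \<open>t \<le> n\<^sup>2\<close> steps from the identity stay close to a set of at most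
  \<open>(C n\<^sup>4)\<^sup>t\<close> matrices. On the other hand a ball of radius \<open>\<rho>\<close> has Haar measure at most
  \<open>n powr (- n\<^sup>2 / 24)\<close> up to factors exponential in \<open>n\<^sup>2\<close> that are beaten by a small choice
  of \<open>\<rho>\<close>. The two logarithms cancel, so the balls around the net can carry mass \<open>1/2\<close> only if \<open>t\<close>
  is at least of order \<open>n\<^sup>2\<close>.

  For the ball estimate, half of the columns of a matrix in the ball are within
  \<open>\<rho> sqrt (2 / n)\<close> of prescribed vectors. Constraining one more column \<open>k\<close>, given the columns in
  \<open>S\<close>, costs a factor \<open>n powr (- c n)\<close>: right multiplication by elements \<open>g\<^sub>w\<close> that
  fix the basis vectors of \<open>S\<close> and send the \<open>k\<close>-th one to a grid point \<open>v\<^sub>w\<close> of the sphere preserves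
  Haar measure, and few of the translated events can hold at once, because the grid
  points involved would be pairwise close and their words thus close in Hamming distance.
\<close>

section \<open>Orthogonal matrices and invariance of the Hilbert-Schmidt distance\<close>

lemma mat_mult_entry:
  fixes a b :: "real mat"
  assumes "a \<in> carrier_mat n n" "b \<in> carrier_mat n n" "i < n" "k < n"
  shows "(a * b) $$ (i, k) = (\<Sum>j<n. a $$ (i, j) * b $$ (j, k))"
  using assms by (simp add: scalar_prod_def atLeast0LessThan)

lemma one_in_SO: "1\<^sub>m n \<in> SO n"
  by (simp add: SO_def)

lemma SO_transpose_mult: "a \<in> SO n \<Longrightarrow> transpose_mat a * a = 1\<^sub>m n"
  using mat_mult_left_right_inverse[of a n "transpose_mat a"] by (simp add: SO_def)

lemma SO_transpose: "a \<in> SO n \<Longrightarrow> transpose_mat a \<in> SO n"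
  using SO_transpose_mult[of a n] by (auto simp: SO_def det_transpose)

text \<open>Vectors are plain functions read on \<open>{..<n}\<close>, so that \<open>L2_set\<close>
  and its triangle inequality apply to them directly.\<close>

definition act :: "nat \<Rightarrow> real mat \<Rightarrow> (nat \<Rightarrow> real) \<Rightarrow> nat \<Rightarrow> real" where
  "act n a v i = (\<Sum>j<n. a $$ (i, j) * v j)"

lemma act_diff: "act n a (\<lambda>j. v j - w j) i = act n a v i - act n a w i"
  by (simp add: act_def right_diff_distrib sum_subtractf)

text \<open>The columns of an element of \<open>SO n\<close> are orthonormal, so expanding the
  squared norm leaves only the diagonal terms.\<close>

lemma L2_set_act:
  assumes a: "a \<in> SO n"
  shows "L2_set (act n a v) {..<n} = L2_set v {..<n}"
proof -
  have orth: "(\<Sum>i<n. a $$ (i, j) * a $$ (i, l)) = of_bool (j = l)" if "j < n" "l < n" for j l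
  proof -
    have "(transpose_mat a * a) $$ (j, l) = (\<Sum>i<n. a $$ (i, j) * a $$ (i, l))"
      using SO_carrier[OF a] that by (simp add: scalar_prod_def atLeast0LessThan)
    then show ?thesis using that by (simp only: SO_transpose_mult[OF a] index_one_mat of_bool_def)
  qed
  have "(\<Sum>i<n. (act n a v i)\<^sup>2) = (\<Sum>i<n. \<Sum>j<n. \<Sum>l<n. (a $$ (i, j) * a $$ (i, l)) * (v j * v l))"
    by (simp add: act_def power2_eq_square sum_product algebra_simps)
  also have "\<dots> = (\<Sum>j<n. \<Sum>l<n. (\<Sum>i<n. a $$ (i, j) * a $$ (i, l)) * (v j * v l))"
    unfolding sum_distrib_right
    by (rule trans[OF sum.swap]) (intro sum.cong refl sum.swap)
  also have "\<dots> = (\<Sum>j<n. \<Sum>l<n. of_bool (j = l) * (v j * v l))"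
    by (intro sum.cong refl) (simp add: orth)
  also have "\<dots> = (\<Sum>j<n. (v j)\<^sup>2)"
    by (intro sum.cong refl) (simp add: power2_eq_square of_bool_def if_distrib[of "\<lambda>x. x * _"] cong: if_cong)
  finally show ?thesis by (simp add: L2_set_def)
qed

lemma hs_eq_columns:
  assumes "a \<in> carrier_mat n n" "b \<in> carrier_mat n n"
  shows "hs a b = L2_set (\<lambda>k. L2_set (\<lambda>i. a $$ (i, k) - b $$ (i, k)) {..<n}) {..<n}"
proof -
  have "(\<Sum>(i, k)\<in>{..<n}\<times>{..<n}. (a $$ (i, k) - b $$ (i, k))\<^sup>2)
    = (\<Sum>k<n. \<Sum>i<n. (a $$ (i, k) - b $$ (i, k))\<^sup>2)"
    unfolding sum.cartesian_product[symmetric] by (rule sum.swap)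
  then show ?thesis
    unfolding hs_eq[OF assms] L2_set_def by (simp add: sum_nonneg case_prod_unfold)
qed

lemma hs_transpose:
  assumes "a \<in> carrier_mat n n" "b \<in> carrier_mat n n"
  shows "hs (transpose_mat a) (transpose_mat b) = hs a b"
proof -
  have c: "transpose_mat a \<in> carrier_mat n n" "transpose_mat b \<in> carrier_mat n n"
    using assms by auto
  have "(\<Sum>(i, j)\<in>{..<n}\<times>{..<n}. (transpose_mat a $$ (i, j) - transpose_mat b $$ (i, j))\<^sup>2)
    = (\<Sum>(i, j)\<in>{..<n}\<times>{..<n}. (a $$ (j, i) - b $$ (j, i))\<^sup>2)"
    using assms by (intro sum.cong) auto
  also have "\<dots> = (\<Sum>(i, j)\<in>{..<n}\<times>{..<n}. (a $$ (i, j) - b $$ (i, j))\<^sup>2)"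
    unfolding sum.cartesian_product[symmetric] by (rule sum.swap)
  finally show ?thesis
    unfolding hs_eq[OF assms] hs_eq[OF c] L2_set_def by (simp add: case_prod_unfold)
qed

text \<open>Left multiplication applies the isometry \<open>g\<close> to each column of the
  difference.\<close>

lemma hs_mult_left:
  assumes g: "g \<in> SO n" and a: "a \<in> carrier_mat n n" and b: "b \<in> carrier_mat n n"
  shows "hs (g * a) (g * b) = hs a b"
proof -
  note c = SO_carrier[OF g]
  have "L2_set (\<lambda>i. (g * a) $$ (i, k) - (g * b) $$ (i, k)) {..<n}
    = L2_set (\<lambda>i. a $$ (i, k) - b $$ (i, k)) {..<n}" if "k < n" for k
  proof -
    have "L2_set (\<lambda>i. (g * a) $$ (i, k) - (g * b) $$ (i, k)) {..<n}
      = L2_set (act n g (\<lambda>i. a $$ (i, k) - b $$ (i, k))) {..<n}"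
      using that a b c
      by (intro L2_set_cong refl)
        (simp add: mat_mult_entry act_def right_diff_distrib sum_subtractf del: index_mult_mat)
    then show ?thesis by (simp add: L2_set_act[OF g])
  qed
  then show ?thesis
    unfolding hs_eq_columns[OF mult_carrier_mat[OF c a] mult_carrier_mat[OF c b]] hs_eq_columns[OF a b]
    by (rule L2_set_cong[OF refl]) auto
qed

text \<open>Transposition preserves \<open>hs\<close> and turns right multiplication into left
  multiplication.\<close>

lemma hs_mult_right:
  assumes g: "g \<in> SO n" and a: "a \<in> carrier_mat n n" and b: "b \<in> carrier_mat n n"
  shows "hs (a * g) (b * g) = hs a b"
proof -
  note c = SO_carrier[OF g]
  have "hs (a * g) (b * g) = hs (transpose_mat g * transpose_mat a) (transpose_mat g * transpose_mat b)"
    using hs_transpose[of "a * g" n "b * g"] a b c by (simp add: transpose_mult[of _ n n])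
  also have "\<dots> = hs a b"
    using hs_mult_left[OF SO_transpose[OF g], of "transpose_mat a" "transpose_mat b"] a b
    by (simp add: hs_transpose)
  finally show ?thesis .
qed

section \<open>Rotations with a prescribed column\<close>

text \<open>\<open>rot\<close> is indexed by increasing pairs; for \<open>j < k\<close> the same
  column arises from the opposite angle.\<close>

lemma SO_plane_rotation:
  assumes "k < n" "j < n" "k \<noteq> j"
  shows "\<exists>R\<in>SO n. (\<forall>i<n. R $$ (i, k) = (if i = k then cos \<theta> else if i = j then sin \<theta> else 0)) \<and>
    (\<forall>i<n. \<forall>l<n. l \<noteq> k \<longrightarrow> l \<noteq> j \<longrightarrow> R $$ (i, l) = of_bool (i = l))"
proof (cases "k < j")
  case True
  show ?thesis
    by (rule bexI[OF _ rot_in_SO[OF True assms(2), of \<theta>]]) (use assms in \<open>auto simp: rot_def\<close>)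
next
  case False
  with assms have "j < k" by simp
  show ?thesis
    by (rule bexI[OF _ rot_in_SO[OF \<open>j < k\<close> assms(1), of "- \<theta>"]]) (use assms in \<open>auto simp: rot_def\<close>)
qed

text \<open>Each index of \<open>F\<close> costs one plane rotation. Positivity of
  \<open>v k\<close> makes the identity work in the base case and keeps the divisor in the induction
  step nonzero.\<close>

lemma SO_with_column:
  assumes "finite F" "F \<subseteq> {..<n}" "k < n" "k \<notin> F" "v k > 0" "(\<Sum>i\<in>insert k F. (v i)\<^sup>2) = 1"
  shows "\<exists>g\<in>SO n. (\<forall>i<n. g $$ (i, k) = (if i \<in> insert k F then v i else 0)) \<and>
     (\<forall>i<n. \<forall>l<n. l \<notin> insert k F \<longrightarrow> g $$ (i, l) = of_bool (i = l))"
  using assms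
proof (induction F arbitrary: v rule: finite_induct)
  case empty
  then have "(v k)\<^sup>2 = 1" by simp
  then have "v k = 1" using empty(4) by (simp add: power2_eq_1_iff)
  then show ?case using empty(2) by (intro bexI[OF _ one_in_SO]) auto
next
  case (insert j F)
  \<comment> \<open>\<open>\<rho>\<close> is the norm of \<open>v\<close> on
    \<open>insert k F\<close>; the induction hypothesis is applied to \<open>v\<close> divided by
    it.\<close>
  define \<rho> where "\<rho> = sqrt (1 - (v j)\<^sup>2)"
  have "(\<Sum>i\<in>insert k F. (v i)\<^sup>2) = 1 - (v j)\<^sup>2"
    using insert.prems(3,5) insert.hyps by (simp add: insert_commute[of k j])
  moreover have "(\<Sum>i\<in>insert k F. (v i)\<^sup>2) > 0"
    using insert.prems(3,4) insert.hyps by (simp add: add_pos_nonneg sum_nonneg)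
  ultimately have \<rho>2: "\<rho>\<^sup>2 = 1 - (v j)\<^sup>2" and \<rho>: "\<rho> > 0"
    and s: "(\<Sum>i\<in>insert k F. (v i)\<^sup>2) = \<rho>\<^sup>2" by (simp_all add: \<rho>_def)
  have "(\<Sum>i\<in>insert k F. (v i / \<rho>)\<^sup>2) = 1"
    using \<rho> s by (simp add: power_divide sum_divide_distrib[symmetric] del: sum.insert)
  from insert.IH[OF _ _ _ _ this] insert.prems \<rho> obtain g where g: "g \<in> SO n"
    "\<And>i. i < n \<Longrightarrow> g $$ (i, k) = (if i \<in> insert k F then v i / \<rho> else 0)"
    "\<And>i l. i < n \<Longrightarrow> l < n \<Longrightarrow> l \<notin> insert k F \<Longrightarrow> g $$ (i, l) = of_bool (i = l)"
    by auto
  have "\<rho>\<^sup>2 + (v j)\<^sup>2 = 1" using \<rho>2 by simp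
  then obtain \<theta> where \<theta>: "\<rho> = cos \<theta>" "v j = sin \<theta>" using sincos_total_2pi by metis
  have kj: "k < n" "j < n" "k \<noteq> j" using insert.prems by auto
  obtain R where R: "R \<in> SO n"
    "\<And>i. i < n \<Longrightarrow> R $$ (i, k) = (if i = k then cos \<theta> else if i = j then sin \<theta> else 0)"
    "\<And>i l. i < n \<Longrightarrow> l < n \<Longrightarrow> l \<noteq> k \<Longrightarrow> l \<noteq> j \<Longrightarrow> R $$ (i, l) = of_bool (i = l)"
    using SO_plane_rotation[OF kj, of \<theta>] by blast
  have R2: "R $$ (i, k) = (if i = k then \<rho> else if i = j then v j else 0)" if "i < n" for i
    using R(2)[OF that] by (simp add: \<theta>)
  note e = mat_mult_entry[OF SO_carrier[OF g(1)] SO_carrier[OF R(1)]]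
  show ?case
  proof (intro bexI[of _ "g * R"] SO_mult g(1) R(1) conjI allI impI)
    fix i assume i: "i < n"
    \<comment> \<open>\<open>R\<close> moves basis vector \<open>k\<close> into the plane of
      \<open>k\<close> and \<open>j\<close>; there \<open>g\<close> fixes basis vector
      \<open>j\<close> and spreads basis vector \<open>k\<close> over
      \<open>insert k F\<close>.\<close>
    have "(g * R) $$ (i, k) = (\<Sum>m\<in>{k, j}. g $$ (i, m) * R $$ (m, k))"
      unfolding e[OF i kj(1)] using kj by (intro sum.mono_neutral_right) (auto simp: R2)
    also have "\<dots> = g $$ (i, k) * \<rho> + g $$ (i, j) * v j"
      using kj by (simp add: R2)
    also have "\<dots> = (if i \<in> insert k (insert j F) then v i else 0)"
      using insert.hyps kj i \<rho> by (auto simp: g(2) g(3)[OF i kj(2)])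
    finally show "(g * R) $$ (i, k) = (if i \<in> insert k (insert j F) then v i else 0)" .
  next
    fix i l assume i: "i < n" "l < n" "l \<notin> insert k (insert j F)"
    have "(g * R) $$ (i, l) = (\<Sum>m\<in>{l}. g $$ (i, m) * R $$ (m, l))"
      unfolding e[OF i(1,2)] using i by (intro sum.mono_neutral_right) (auto simp: R(3))
    also have "\<dots> = of_bool (i = l)" using i by (simp add: R(3) g(3))
    finally show "(g * R) $$ (i, l) = of_bool (i = l)" .
  qed
qed

section \<open>Counting close words and integrating overlaps\<close>

text \<open>With one word \<open>w0\<close> of \<open>U\<close> fixed, a word is determined by the
  set of positions where it differs from \<open>w0\<close> and by its letters there. There are at
  most \<open>2 ^ card T\<close> such sets and at most \<open>L ^ d\<close> fillings of
  each.\<close>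

lemma card_words_close:
  assumes T: "finite T" and "L > 0" and U: "U \<subseteq> T \<rightarrow>\<^sub>E {..<L::nat}"
    and close: "\<And>w w'. w \<in> U \<Longrightarrow> w' \<in> U \<Longrightarrow> card {j\<in>T. w j \<noteq> w' j} \<le> d"
  shows "card U \<le> 2 ^ card T * L ^ d"
proof (cases "U = {}")
  case False
  then obtain w0 where w0: "w0 \<in> U" by blast
  define D where "D w = {j\<in>T. w j \<noteq> w0 j}" for w
  let ?P = "SIGMA X:{X. X \<subseteq> T \<and> card X \<le> d}. X \<rightarrow>\<^sub>E {..<L}"
  have fin: "finite {X. X \<subseteq> T \<and> card X \<le> d}" using T by (auto intro: finite_subset[of _ "Pow T"])
  have finX: "finite X" if "X \<subseteq> T" for X using that T by (rule finite_subset)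
  have "card U \<le> card ?P"
  proof (rule card_inj_on_le)
    show "(\<lambda>w. (D w, restrict w (D w))) ` U \<subseteq> ?P"
    proof (intro image_subsetI)
      fix w assume w: "w \<in> U"
      then have "w \<in> T \<rightarrow>\<^sub>E {..<L}" using U by blast
      then have "restrict w (D w) \<in> D w \<rightarrow>\<^sub>E {..<L}" by (auto simp: D_def)
      moreover have "D w \<subseteq> T" "card (D w) \<le> d" using close[OF w w0] by (auto simp: D_def)
      ultimately show "(D w, restrict w (D w)) \<in> ?P" by blast
    qed
    show "finite ?P" using finX by (intro finite_SigmaI fin finite_PiE) auto
    show "inj_on (\<lambda>w. (D w, restrict w (D w))) U"
    proof (rule inj_onI)
      fix w w' assume w: "w \<in> U" "w' \<in> U" "(D w, restrict w (D w)) = (D w', restrict w' (D w'))"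
      show "w = w'"
      proof (rule PiE_ext)
        show "w \<in> T \<rightarrow>\<^sub>E {..<L}" "w' \<in> T \<rightarrow>\<^sub>E {..<L}" using w U by auto
        fix j assume "j \<in> T"
        show "w j = w' j"
        proof (cases "j \<in> D w")
          case True then show ?thesis using w(3) by (metis prod.inject restrict_apply')
        next
          case False
          then have "j \<notin> D w" "j \<notin> D w'" using w(3) by auto
          then show ?thesis using \<open>j \<in> T\<close> by (simp add: D_def)
        qed
      qed
    qed
  qed
  also have "\<dots> = (\<Sum>X\<in>{X. X \<subseteq> T \<and> card X \<le> d}. L ^ card X)"
    using finX by (subst card_SigmaI[OF fin]) (auto simp: finite_PiE card_PiE)
  also have "\<dots> \<le> (\<Sum>X\<in>{X. X \<subseteq> T \<and> card X \<le> d}. L ^ d)"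
    using \<open>L > 0\<close> by (intro sum_mono power_increasing) auto
  also have "\<dots> = card {X. X \<subseteq> T \<and> card X \<le> d} * L ^ d" by simp
  also have "card {X. X \<subseteq> T \<and> card X \<le> d} \<le> card (Pow T)"
    using T by (intro card_mono) auto
  finally show ?thesis using T by (simp add: card_Pow)
qed simp

text \<open>The sum of the measures is the integral of the number of sets containing a point, so a
  pointwise bound on the multiplicity suffices.\<close>

lemma (in finite_measure) sum_measure_le_overlap:
  assumes I: "finite I" and A: "\<And>i. i \<in> I \<Longrightarrow> A i \<in> sets M" and B: "B \<in> sets M"
    and overlap: "\<And>x. x \<in> space M \<Longrightarrow> real (card {i\<in>I. x \<in> A i}) \<le> c * indicator B x"
  shows "(\<Sum>i\<in>I. measure M (A i)) \<le> c * measure M B"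
proof -
  have int: "integrable M (indicator X :: _ \<Rightarrow> real)" if "X \<in> sets M" for X
    using that by (simp add: emeasure_eq_measure)
  have m: "(\<integral>x. indicator X x \<partial>M) = measure M X" if "X \<in> sets M" for X
    using sets.sets_into_space[OF that] by (simp add: Int_absorb2)
  have "(\<Sum>i\<in>I. measure M (A i)) = (\<integral>x. (\<Sum>i\<in>I. indicator (A i) x) \<partial>M)"
    using A int m by (subst Bochner_Integration.integral_sum) auto
  also have "\<dots> \<le> (\<integral>x. c * indicator B x \<partial>M)"
  proof (rule integral_mono)
    show "integrable M (\<lambda>x. \<Sum>i\<in>I. indicator (A i) x :: real)"
      using A int by (intro Bochner_Integration.integrable_sum) auto
    show "integrable M (\<lambda>x. c * indicator B x)"
      using int[OF B] by (rule integrable_mult_right)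
    fix x assume "x \<in> space M"
    from overlap[OF this] show "(\<Sum>i\<in>I. indicator (A i) x) \<le> c * indicator B x"
      using I by (simp add: indicator_def of_bool_def sum.If_cases Collect_conj_eq Int_commute)
  qed
  finally show ?thesis using m[OF B] by simp
qed

section \<open>Right translations and Haar measure\<close>

lemma measurable_mult_right_SO:
  assumes g: "g \<in> SO n"
  shows "(\<lambda>a. a * g) \<in> measurable (SO_borel n) (SO_borel n)"
proof (rule measurable_SO_borelI)
  show "a * g \<in> SO n" if "a \<in> space (SO_borel n)" for a
    using that g by (simp add: SO_mult)
  fix i j assume ij: "i < n" "j < n"
  have "(\<lambda>a. \<Sum>l<n. a $$ (i, l) * g $$ (l, j)) \<in> borel_measurable (SO_borel n)"
    using ij by (intro borel_measurable_sum borel_measurable_times measurable_entry) auto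
  also have "?this \<longleftrightarrow> (\<lambda>a. (a * g) $$ (i, j)) \<in> borel_measurable (SO_borel n)"
    by (intro measurable_cong)
      (simp add: mat_mult_entry[OF SO_carrier SO_carrier[OF g] ij] del: index_mult_mat)
  finally show "(\<lambda>a. (a * g) $$ (i, j)) \<in> borel_measurable (SO_borel n)" .
qed

lemma is_haarD:
  assumes "is_haar n H"
  shows "prob_space H" "sets H = sets (SO_borel n)" "space H = SO n"
proof -
  show "prob_space H" and s: "sets H = sets (SO_borel n)"
    using assms by (auto simp: is_haar_def borel_prob_def)
  show "space H = SO n" using sets_eq_imp_space_eq[OF s] by simp
qed

text \<open>\<open>is_haar\<close> speaks of images. Right multiplication by \<open>g\<close> is
  inverted on \<open>SO n\<close> by the transpose of \<open>g\<close>, so the image of the preimage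
  is all of \<open>E\<close>.\<close>

lemma haar_preimage:
  assumes H: "is_haar n H" and g: "g \<in> SO n" and E: "E \<in> sets (SO_borel n)"
  shows "{a \<in> SO n. a * g \<in> E} \<in> sets (SO_borel n)"
    and "measure H {a \<in> SO n. a * g \<in> E} = measure H E"
proof -
  let ?E = "{a \<in> SO n. a * g \<in> E}"
  have "?E = (\<lambda>a. a * g) -` E \<inter> space (SO_borel n)" by auto
  then show *: "?E \<in> sets (SO_borel n)"
    using measurable_sets[OF measurable_mult_right_SO[OF g] E] by simp
  have "(\<lambda>x. x * g) ` ?E = E"
  proof (intro equalityI subsetI)
    fix e assume e: "e \<in> E"
    then have "e \<in> SO n" using sets.sets_into_space[OF E] by auto
    have "e * transpose_mat g * g = e * (transpose_mat g * g)"
      using SO_carrier[OF \<open>e \<in> SO n\<close>] SO_carrier[OF g] by (intro assoc_mult_mat[of _ n n _ n _ n]) auto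
    then have "e * transpose_mat g * g = e"
      using SO_carrier[OF \<open>e \<in> SO n\<close>] by (simp add: SO_transpose_mult[OF g])
    moreover have "e * transpose_mat g \<in> SO n"
      using \<open>e \<in> SO n\<close> g by (intro SO_mult SO_transpose)
    ultimately show "e \<in> (\<lambda>x. x * g) ` ?E" using e by (intro image_eqI[of _ _ "e * transpose_mat g"]) auto
  qed auto
  moreover have "emeasure H ((\<lambda>x. x * g) ` ?E) = emeasure H ?E"
    using H g * by (simp add: is_haar_def)
  ultimately show "measure H ?E = measure H E" by (simp add: measure_def)
qed

section \<open>Haar measure of small balls\<close>

text \<open>Enlarging \<open>S\<close> one column at a time leads from all of \<open>SO n\<close> to
  a set that controls half of the columns.\<close>

definition column_balls :: "nat \<Rightarrow> real mat \<Rightarrow> real \<Rightarrow> nat set \<Rightarrow> real mat set" where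
  "column_balls n y r S =
    {a \<in> SO n. \<forall>k\<in>S. L2_set (\<lambda>i. a $$ (i, k) - y $$ (i, k)) {..<n} \<le> r}"

lemma sets_column_balls:
  assumes "S \<subseteq> {..<n}"
  shows "column_balls n y r S \<in> sets (SO_borel n)"
proof -
  have "{a \<in> space (SO_borel n). \<forall>k\<in>S. L2_set (\<lambda>i. a $$ (i, k) - y $$ (i, k)) {..<n} \<le> r}
    \<in> sets (SO_borel n)"
  proof (intro sets.sets_Collect_finite_All borel_measurable_le borel_measurable_const)
    show "finite S" using assms by (rule finite_subset) simp
    fix k assume "k \<in> S"
    then have "k < n" using assms by auto
    then show "(\<lambda>a. L2_set (\<lambda>i. a $$ (i, k) - y $$ (i, k)) {..<n}) \<in> borel_measurable (SO_borel n)"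
      unfolding L2_set_def
      by (intro measurable_compose[OF _ borel_measurable_sqrt] borel_measurable_sum borel_measurable_power borel_measurable_diff
          borel_measurable_const measurable_entry) auto
  qed
  then show ?thesis by (simp add: column_balls_def)
qed

text \<open>A word over \<open>L\<close> letters on the \<open>m\<close> indices outside
  \<open>insert k S\<close> gives a translate of the smaller set. All \<open>L ^ m\<close>
  translates have the same Haar measure and lie in the larger set, and no point is in more than
  \<open>2 ^ m * L ^ d\<close> of them. Here \<open>hL\<close> fits the grid of mesh
  \<open>h\<close> into the unit ball, and \<open>rh\<close> forces words whose translates share a
  point to differ in at most \<open>d\<close> letters.\<close>

lemma haar_column_balls_insert:
  assumes H: "is_haar n H" and S: "S \<subseteq> {..<n}" and k: "k < n" "k \<notin> S" and L: "L > 0" and h: "h > 0"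
    and hL: "real n * (h * real L)\<^sup>2 \<le> 1" and rh: "4 * r\<^sup>2 < real (Suc d) * h\<^sup>2"
  defines "m \<equiv> n - card S - 1"
  shows "real L ^ m * measure H (column_balls n y r (insert k S))
    \<le> 2 ^ m * real L ^ d * measure H (column_balls n y r S)"
proof -
  interpret prob_space H by (rule is_haarD[OF H])
  note setsH = is_haarD(2)[OF H]
  define T where "T = {..<n} - insert k S"
  have T: "finite T" "T \<subseteq> {..<n}" "k \<notin> T" by (auto simp: T_def)
  have "card T = n - card (insert k S)"
    unfolding T_def using S k by (subst card_Diff_subset) (auto intro: finite_subset)
  then have card_T: "card T = m" using S k finite_subset[OF S] by (simp add: m_def)
  have "m < n" using k by (simp add: m_def)
  define W where "W = T \<rightarrow>\<^sub>E {..<L}"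
  \<comment> \<open>Coordinate \<open>k\<close> completes the grid vector to a unit vector; by
    \<open>small\<close> it is positive, as \<open>SO_with_column\<close> requires.\<close>
  define v where "v w j = (if j = k then sqrt (1 - (\<Sum>j\<in>T. (h * real (w j))\<^sup>2))
      else if j \<in> T then h * real (w j) else 0)" for w :: "nat \<Rightarrow> nat" and j
  have small: "(\<Sum>j\<in>T. (h * real (w j))\<^sup>2) < 1" if "w \<in> W" for w
  proof -
    have "(\<Sum>j\<in>T. (h * real (w j))\<^sup>2) \<le> (\<Sum>j\<in>T. (h * real L)\<^sup>2)"
      using that h by (intro sum_mono power_mono mult_left_mono) (auto simp: W_def PiE_iff less_imp_le)
    also have "\<dots> = real m * (h * real L)\<^sup>2" by (simp add: card_T)
    also have "\<dots> < real n * (h * real L)\<^sup>2"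
      using \<open>m < n\<close> h L by (intro mult_strict_right_mono) auto
    finally show ?thesis using hL by linarith
  qed
  have "\<exists>g\<in>SO n. (\<forall>i<n. g $$ (i, k) = v w i) \<and> (\<forall>i<n. \<forall>l\<in>S. g $$ (i, l) = of_bool (i = l))"
    if w: "w \<in> W" for w
  proof -
    have "(v w k)\<^sup>2 = 1 - (\<Sum>j\<in>T. (h * real (w j))\<^sup>2)" using small[OF w] by (simp add: v_def)
    moreover have "(\<Sum>j\<in>T. (v w j)\<^sup>2) = (\<Sum>j\<in>T. (h * real (w j))\<^sup>2)"
      using T by (intro sum.cong) (auto simp: v_def)
    ultimately have "(\<Sum>i\<in>insert k T. (v w i)\<^sup>2) = 1" using T by simp
    moreover have "v w k > 0" using small[OF w] by (simp add: v_def)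
    ultimately obtain g where g: "g \<in> SO n" "\<forall>i<n. g $$ (i, k) = (if i \<in> insert k T then v w i else 0)"
      "\<forall>i<n. \<forall>l<n. l \<notin> insert k T \<longrightarrow> g $$ (i, l) = of_bool (i = l)"
      using SO_with_column[OF T(1,2) k(1) T(3), of "v w"] by blast
    show ?thesis
    proof (intro bexI[OF _ g(1)] conjI allI ballI impI)
      show "g $$ (i, k) = v w i" if "i < n" for i using g(2) that by (auto simp: v_def)
      show "g $$ (i, l) = of_bool (i = l)" if "i < n" "l \<in> S" for i l
      proof -
        have "l < n" "l \<notin> insert k T" using that S k by (auto simp: T_def)
        then show ?thesis using g(3) that by blast
      qed
    qed
  qed
  then obtain g where g: "\<And>w. w \<in> W \<Longrightarrow> g w \<in> SO n"
    "\<And>w i. w \<in> W \<Longrightarrow> i < n \<Longrightarrow> g w $$ (i, k) = v w i"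
    "\<And>w i l. w \<in> W \<Longrightarrow> i < n \<Longrightarrow> l \<in> S \<Longrightarrow> g w $$ (i, l) = of_bool (i = l)"
    by metis
  define E where "E = column_balls n y r (insert k S)"
  have E: "E \<in> sets (SO_borel n)" unfolding E_def using S k by (intro sets_column_balls) auto
  define A where "A w = {a \<in> SO n. a * g w \<in> E}" for w
  \<comment> \<open>\<open>g w\<close> fixes the basis vectors indexed by \<open>S\<close>, so the
    translation does not disturb the constraints already imposed.\<close>
  have col_S: "(a * g w) $$ (i, l) = a $$ (i, l)" if "a \<in> SO n" "w \<in> W" "i < n" "l \<in> S" for a w i l
  proof -
    have "l < n" using that S by auto
    have "(a * g w) $$ (i, l) = (\<Sum>j\<in>{l}. a $$ (i, j) * g w $$ (j, l))"
      unfolding mat_mult_entry[OF SO_carrier[OF that(1)] SO_carrier[OF g(1)[OF that(2)]] that(3) \<open>l < n\<close>]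
      using that \<open>l < n\<close> by (intro sum.mono_neutral_right) (auto simp: g(3))
    then show ?thesis using that \<open>l < n\<close> by (simp add: g(3))
  qed
  have col_k: "(a * g w) $$ (i, k) = act n a (v w) i" if "a \<in> SO n" "w \<in> W" "i < n" for a w i
    unfolding mat_mult_entry[OF SO_carrier[OF that(1)] SO_carrier[OF g(1)[OF that(2)]] that(3) k(1)] act_def
    using that by (intro sum.cong) (auto simp: g(2))
  have A_S: "a \<in> column_balls n y r S" if "a \<in> A w" "w \<in> W" for a w
  proof -
    have a: "a \<in> SO n" "a * g w \<in> E" using that by (auto simp: A_def)
    have "L2_set (\<lambda>i. a $$ (i, l) - y $$ (i, l)) {..<n} \<le> r" if "l \<in> S" for l
    proof -
      have "L2_set (\<lambda>i. a $$ (i, l) - y $$ (i, l)) {..<n} = L2_set (\<lambda>i. (a * g w) $$ (i, l) - y $$ (i, l)) {..<n}"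
        using col_S[OF a(1) \<open>w \<in> W\<close> _ that] by (intro L2_set_cong) auto
      then show ?thesis using a(2) that by (simp add: E_def column_balls_def)
    qed
    then show ?thesis using a(1) by (simp add: column_balls_def)
  qed
  have A_k: "L2_set (\<lambda>i. act n a (v w) i - y $$ (i, k)) {..<n} \<le> r" if "a \<in> A w" "w \<in> W" for a w
  proof -
    have a: "a \<in> SO n" "a * g w \<in> E" using that by (auto simp: A_def)
    have "L2_set (\<lambda>i. act n a (v w) i - y $$ (i, k)) {..<n} = L2_set (\<lambda>i. (a * g w) $$ (i, k) - y $$ (i, k)) {..<n}"
      using col_k[OF a(1) that(2)] by (intro L2_set_cong) auto
    then show ?thesis using a(2) by (simp add: E_def column_balls_def)
  qed
  have overlap: "card {w\<in>W. a \<in> A w} \<le> 2 ^ m * L ^ d" for a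
  proof -
    have "card {w\<in>W. a \<in> A w} \<le> 2 ^ card T * L ^ d"
    proof (rule card_words_close[OF T(1) L])
      show "{w\<in>W. a \<in> A w} \<subseteq> T \<rightarrow>\<^sub>E {..<L}" by (auto simp: W_def)
      fix w w' assume "w \<in> {w\<in>W. a \<in> A w}" "w' \<in> {w\<in>W. a \<in> A w}"
      then have w: "w \<in> W" "a \<in> A w" and w': "w' \<in> W" "a \<in> A w'" by auto
      have a: "a \<in> SO n" using w by (simp add: A_def)
      let ?D = "{j\<in>T. w j \<noteq> w' j}"
      \<comment> \<open>\<open>a\<close> is an isometry that maps both grid vectors into the
        \<open>r\<close>-ball around column \<open>k\<close> of \<open>y\<close>, so they are at
        most \<open>2 * r\<close> apart.\<close>
      have "L2_set (\<lambda>j. v w j - v w' j) {..<n} = L2_set (\<lambda>i. act n a (v w) i - act n a (v w') i) {..<n}"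
        unfolding act_diff[symmetric] by (rule L2_set_act[OF a, symmetric])
      also have "\<dots> = L2_set (\<lambda>i. (act n a (v w) i - y $$ (i, k)) + - (act n a (v w') i - y $$ (i, k))) {..<n}"
        by simp
      also have "\<dots> \<le> L2_set (\<lambda>i. act n a (v w) i - y $$ (i, k)) {..<n}
          + L2_set (\<lambda>i. - (act n a (v w') i - y $$ (i, k))) {..<n}"
        by (rule L2_set_triangle_ineq)
      also have "L2_set (\<lambda>i. - (act n a (v w') i - y $$ (i, k))) {..<n}
          = L2_set (\<lambda>i. act n a (v w') i - y $$ (i, k)) {..<n}"
        by (simp add: L2_set_def power2_commute)
      also have "L2_set (\<lambda>i. act n a (v w) i - y $$ (i, k)) {..<n} + \<dots> \<le> 2 * r"
        using A_k[OF w(2,1)] A_k[OF w'(2,1)] by simp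
      finally have "(L2_set (\<lambda>j. v w j - v w' j) {..<n})\<^sup>2 \<le> (2 * r)\<^sup>2"
        by (intro power_mono) simp_all
      then have "(\<Sum>j<n. (v w j - v w' j)\<^sup>2) \<le> 4 * r\<^sup>2"
        by (simp add: L2_set_def sum_nonneg power_mult_distrib)
      \<comment> \<open>Each differing letter separates the two grid vectors by at least
        \<open>h\<close> in its coordinate.\<close>
      moreover have "real (card ?D) * h\<^sup>2 \<le> (\<Sum>j<n. (v w j - v w' j)\<^sup>2)"
      proof -
        have "real (card ?D) * h\<^sup>2 = (\<Sum>j\<in>?D. h\<^sup>2 * 1)" by simp
        also have "\<dots> \<le> (\<Sum>j\<in>?D. h\<^sup>2 * (real (w j) - real (w' j))\<^sup>2)"
        proof (intro sum_mono mult_left_mono)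
          fix j assume "j \<in> ?D"
          then have "1 \<le> \<bar>real (w j) - real (w' j)\<bar>" by auto
          then show "1 \<le> (real (w j) - real (w' j))\<^sup>2" using abs_le_square_iff[of 1 "real (w j) - real (w' j)"] by simp
        qed simp
        also have "\<dots> = (\<Sum>j\<in>?D. (v w j - v w' j)\<^sup>2)"
          using T by (intro sum.cong) (auto simp: v_def power2_eq_square algebra_simps)
        also have "\<dots> \<le> (\<Sum>j<n. (v w j - v w' j)\<^sup>2)"
          using T by (intro sum_mono2) auto
        finally show ?thesis .
      qed
      ultimately have "real (card ?D) * h\<^sup>2 < real (Suc d) * h\<^sup>2" using rh by linarith
      then have "real (card ?D) < real (Suc d)" using h by (simp only: mult_less_cancel_right) auto
      then show "card ?D \<le> d" by simp
    qed
    then show ?thesis by (simp add: card_T)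
  qed
  have "(\<Sum>w\<in>W. measure H (A w)) \<le> real (2 ^ m * L ^ d) * measure H (column_balls n y r S)"
  proof (rule sum_measure_le_overlap)
    show "finite W" using T by (auto simp: W_def intro: finite_PiE)
    show "A w \<in> sets H" if "w \<in> W" for w
      unfolding A_def setsH by (rule haar_preimage(1)[OF H g(1)[OF that] E])
    show "column_balls n y r S \<in> sets H" unfolding setsH by (rule sets_column_balls[OF S])
    show "real (card {w\<in>W. a \<in> A w}) \<le> real (2 ^ m * L ^ d) * indicator (column_balls n y r S) a" for a
    proof (cases "a \<in> column_balls n y r S")
      case True
      then show ?thesis using overlap[of a] by (simp only: of_nat_le_iff indicator_simps mult_1_right)
    next
      case False
      then have "{w\<in>W. a \<in> A w} = {}" using A_S by blast
      then show ?thesis by (simp only: card.empty) simp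
    qed
  qed
  also have "(\<Sum>w\<in>W. measure H (A w)) = (\<Sum>w\<in>W. measure H E)"
    unfolding A_def by (intro sum.cong refl haar_preimage(2)[OF H g(1) E])
  also have "\<dots> = real L ^ m * measure H E"
    using T by (simp add: W_def card_PiE card_T)
  finally show ?thesis by (simp add: E_def)
qed

text \<open>The one-column estimate is iterated with \<open>d = n div 4\<close>. While fewer than
  \<open>n div 2\<close> columns are constrained, \<open>m - d\<close> is at least
  \<open>n / 4\<close>, which gives the exponent of \<open>L\<close>.\<close>

lemma haar_column_balls_le:
  assumes H: "is_haar n H" and L: "L > 0" and h: "h > 0"
    and hL: "real n * (h * real L)\<^sup>2 \<le> 1" and rh: "4 * r\<^sup>2 < real (Suc (n div 4)) * h\<^sup>2"
    and "finite S" "S \<subseteq> {..<n}" "card S \<le> n div 2"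
  shows "measure H (column_balls n y r S) \<le> (2 ^ n / real L powr (real n / 4)) ^ card S"
  using assms(6-)
proof (induction S rule: finite_induct)
  case empty
  interpret prob_space H by (rule is_haarD[OF H])
  show ?case by simp
next
  case (insert k S)
  define m where "m = n - card S - 1"
  define d where "d = n div 4"
  let ?E = "\<lambda>S. measure H (column_balls n y r S)"
  have m: "card S < n div 2" using insert by simp
  then have md: "d \<le> m" and "real n / 4 \<le> real (m - d)" and "m \<le> n"
    unfolding m_def d_def by linarith+
  have "real L powr (real n / 4) \<le> real L powr real (m - d)"
    using L \<open>real n / 4 \<le> real (m - d)\<close> by (intro powr_mono) auto
  then have Lm: "real L powr (real n / 4) \<le> real L ^ (m - d)" using L by (simp add: powr_realpow)
  have "real L ^ d * (real L ^ (m - d) * ?E (insert k S)) = real L ^ m * ?E (insert k S)"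
    using md by (simp add: power_add[symmetric] mult.assoc[symmetric])
  also have "\<dots> \<le> 2 ^ m * real L ^ d * ?E S"
    unfolding m_def d_def
    by (rule haar_column_balls_insert[OF H _ _ _ L h hL rh]) (use insert in auto)
  finally have "real L ^ d * (real L ^ (m - d) * ?E (insert k S)) \<le> real L ^ d * (2 ^ m * ?E S)"
    by (simp add: mult_ac)
  then have "real L ^ (m - d) * ?E (insert k S) \<le> 2 ^ m * ?E S"
    using L by simp
  also have "\<dots> \<le> 2 ^ n * ?E S"
    using \<open>m \<le> n\<close> by (intro mult_right_mono power_increasing) auto
  finally have "real L powr (real n / 4) * ?E (insert k S) \<le> 2 ^ n * ?E S"
    using mult_right_mono[OF Lm, of "?E (insert k S)"] by simp
  then have "?E (insert k S) \<le> 2 ^ n / real L powr (real n / 4) * ?E S"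
    using L by (simp add: field_simps)
  also have "\<dots> \<le> 2 ^ n / real L powr (real n / 4) * (2 ^ n / real L powr (real n / 4)) ^ card S"
    using insert by (intro mult_left_mono) auto
  finally show ?case using insert by simp
qed

text \<open>The squared column distances sum to less than \<open>\<rho>\<^sup>2\<close>, so at most
  half of them exceed \<open>2 * \<rho>\<^sup>2 / n\<close>.\<close>

lemma ball_subset_column_balls:
  assumes n: "n > 0" and y: "y \<in> SO n" and a: "a \<in> SO n" and close: "hs y a < \<rho>"
  shows "\<exists>S. S \<subseteq> {..<n} \<and> card S = n div 2 \<and> a \<in> column_balls n y (\<rho> * sqrt (2 / real n)) S"
proof -
  define r where "r = \<rho> * sqrt (2 / real n)"
  have "\<rho> > 0" using close hs_nonneg[of y a] by linarith
  then have r: "r > 0" using n by (simp add: r_def)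
  define f where "f k = L2_set (\<lambda>i. a $$ (i, k) - y $$ (i, k)) {..<n}" for k
  define D where "D = {k\<in>{..<n}. r < f k}"
  have "hs y a = L2_set f {..<n}"
    unfolding hs_commute[OF SO_carrier[OF y] SO_carrier[OF a]] hs_eq_columns[OF SO_carrier[OF a] SO_carrier[OF y]]
    by (simp add: f_def[abs_def])
  then have sq: "(\<Sum>k<n. (f k)\<^sup>2) = (hs y a)\<^sup>2" by (simp add: L2_set_def sum_nonneg)
  have "real (card D) * r\<^sup>2 = (\<Sum>k\<in>D. r\<^sup>2)" by simp
  also have "\<dots> \<le> (\<Sum>k\<in>D. (f k)\<^sup>2)"
    using r by (intro sum_mono power_mono) (auto simp: D_def)
  also have "\<dots> \<le> (\<Sum>k<n. (f k)\<^sup>2)" by (intro sum_mono2) (auto simp: D_def)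
  also have "\<dots> \<le> \<rho>\<^sup>2" unfolding sq using close hs_nonneg by (intro power_mono) auto
  finally have "real (card D) * (2 / real n) * \<rho>\<^sup>2 \<le> 1 * \<rho>\<^sup>2"
    using n by (simp add: r_def power_mult_distrib mult_ac)
  then have "real (card D) * (2 / real n) \<le> 1"
    using \<open>\<rho> > 0\<close> by (simp only: mult_le_cancel_right) auto
  then have "2 * card D \<le> n" using n by (simp add: field_simps)
  moreover have "card ({..<n} - D) = n - card D"
    by (subst card_Diff_subset) (auto simp: D_def)
  ultimately have "n div 2 \<le> card ({..<n} - D)" by linarith
  then obtain S where S: "S \<subseteq> {..<n} - D" "card S = n div 2"
    using obtain_subset_with_card_n by metis
  have "a \<in> column_balls n y r S"
    using S(1) a by (auto simp: column_balls_def D_def f_def not_less)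
  then show ?thesis using S unfolding r_def by blast
qed

text \<open>Union bound over the at most \<open>2 ^ n\<close> choices of \<open>n div 2\<close> good
  columns.\<close>

lemma haar_ball_le:
  assumes H: "is_haar n H" and n: "n > 0" and y: "y \<in> SO n" and L: "L > 0"
    and \<rho>: "32 * \<rho>\<^sup>2 * (real L)\<^sup>2 \<le> real n"
  shows "measure H {a \<in> SO n. hs y a < \<rho>} \<le> 2 ^ n * (2 ^ n / real L powr (real n / 4)) ^ (n div 2)"
proof -
  interpret prob_space H by (rule is_haarD[OF H])
  note setsH = is_haarD(2)[OF H]
  define r where "r = \<rho> * sqrt (2 / real n)"
  \<comment> \<open>The largest mesh allowed by \<open>hL\<close>, which then holds with
    equality.\<close>
  define h where "h = 1 / (real L * sqrt (real n))"
  have h: "h > 0" using n L by (simp add: h_def)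
  have hL: "real n * (h * real L)\<^sup>2 \<le> 1"
    using n L by (simp add: h_def power_divide)
  \<comment> \<open>The ratio of \<open>4 * r\<^sup>2\<close> to \<open>h\<^sup>2\<close> is
    \<open>8 * \<rho>\<^sup>2 * (real L)\<^sup>2\<close>, at most \<open>n / 4\<close> by
    assumption; \<open>Suc\<close> makes the rounded quarter exceed it.\<close>
  have "real n / 4 < real (Suc (n div 4))" by linarith
  then have "8 * \<rho>\<^sup>2 * (real L)\<^sup>2 < real (Suc (n div 4))" using \<rho> by linarith
  then have rh: "4 * r\<^sup>2 < real (Suc (n div 4)) * h\<^sup>2"
    using n L by (simp add: r_def h_def power_mult_distrib power_divide field_simps)
  define \<S> where "\<S> = {S. S \<subseteq> {..<n} \<and> card S = n div 2}"
  have fin: "finite \<S>" unfolding \<S>_def by simp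
  have "card \<S> \<le> card (Pow {..<n})" unfolding \<S>_def by (intro card_mono) auto
  then have card: "card \<S> \<le> 2 ^ n" by (simp add: card_Pow)
  have sets: "column_balls n y r S \<in> sets H" if "S \<in> \<S>" for S
    using that unfolding setsH by (intro sets_column_balls) (auto simp: \<S>_def)
  have "measure H {a \<in> SO n. hs y a < \<rho>} \<le> measure H (\<Union>S\<in>\<S>. column_balls n y r S)"
    using ball_subset_column_balls[OF n y] sets fin
    by (intro finite_measure_mono sets.finite_UN) (auto simp: \<S>_def r_def)
  also have "\<dots> \<le> (\<Sum>S\<in>\<S>. measure H (column_balls n y r S))"
    using sets fin by (intro finite_measure_subadditive_finite) auto
  also have "\<dots> \<le> (\<Sum>S\<in>\<S>. (2 ^ n / real L powr (real n / 4)) ^ (n div 2))"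
  proof (intro sum_mono)
    fix S assume "S \<in> \<S>"
    then have S: "S \<subseteq> {..<n}" "card S = n div 2" by (auto simp: \<S>_def)
    then show "measure H (column_balls n y r S) \<le> (2 ^ n / real L powr (real n / 4)) ^ (n div 2)"
      using haar_column_balls_le[OF H L h hL rh, of S y] finite_subset[OF S(1)] by simp
  qed
  also have "\<dots> = real (card \<S>) * (2 ^ n / real L powr (real n / 4)) ^ (n div 2)" by simp
  also have "\<dots> \<le> real (2 ^ n) * (2 ^ n / real L powr (real n / 4)) ^ (n div 2)"
    using card by (intro mult_right_mono) (simp_all only: of_nat_le_iff, simp)
  finally show ?thesis by simp
qed

section \<open>Discretised angles and the reach of the walk\<close>

definition hs_nbhd :: "nat \<Rightarrow> real mat set \<Rightarrow> real \<Rightarrow> real mat set" where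
  "hs_nbhd n F s = {x \<in> SO n. \<exists>y\<in>F. hs y x < s}"

lemma sets_hs_nbhd:
  assumes "F \<subseteq> SO n"
  shows "hs_nbhd n F s \<in> sets (SO_borel n)"
  unfolding sets_SO_borel
proof (intro sigma_sets.Basic CollectI conjI ballI)
  show "hs_nbhd n F s \<subseteq> SO n" by (auto simp: hs_nbhd_def)
  fix x assume "x \<in> hs_nbhd n F s"
  then obtain y where y: "y \<in> F" "hs y x < s" and x: "x \<in> SO n" by (auto simp: hs_nbhd_def)
  have "z \<in> hs_nbhd n F s" if z: "z \<in> SO n" "hs x z < s - hs y x" for z
  proof -
    have "hs y z \<le> hs y x + hs x z"
      using y x z assms by (intro hs_triangle[of _ n] SO_carrier) auto
    then have "hs y z < s" using z by simp
    then show ?thesis using z y by (auto simp: hs_nbhd_def)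
  qed
  then show "\<exists>r>0. \<forall>z\<in>SO n. hs x z < r \<longrightarrow> z \<in> hs_nbhd n F s"
    using y by (intro exI[of _ "s - hs y x"]) auto
qed

lemma abs_sin_diff_le: "\<bar>sin x - sin y\<bar> \<le> \<bar>x - y :: real\<bar>"
proof -
  have "\<bar>sin x - sin y\<bar> = 2 * \<bar>sin ((x - y) / 2)\<bar> * \<bar>cos ((x + y) / 2)\<bar>"
    by (simp add: sin_diff_sin abs_mult)
  also have "\<dots> \<le> 2 * \<bar>(x - y) / 2\<bar> * 1"
    by (intro mult_mono abs_sin_x_le_abs_x abs_cos_le_one) auto
  finally show ?thesis by simp
qed

lemma abs_cos_diff_le: "\<bar>cos x - cos y\<bar> \<le> \<bar>x - y :: real\<bar>"
  using abs_sin_diff_le[of "pi / 2 - x" "pi / 2 - y"] by (simp add: sin_diff abs_minus_commute)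

text \<open>Only four entries depend on the angle, each 1-Lipschitz in it, and the norm is at most
  the sum of the absolute values.\<close>

lemma hs_rot_le:
  assumes "i < j" "j < n"
  shows "hs (rot n i j \<theta>) (rot n i j \<phi>) \<le> 4 * \<bar>\<theta> - \<phi>\<bar>"
proof -
  let ?d = "\<lambda>(k, l). rot n i j \<theta> $$ (k, l) - rot n i j \<phi> $$ (k, l)"
  have "hs (rot n i j \<theta>) (rot n i j \<phi>) \<le> (\<Sum>p\<in>{..<n}\<times>{..<n}. \<bar>?d p\<bar>)"
    unfolding hs_eq[OF rot_carrier rot_carrier] by (rule L2_set_le_sum_abs)
  also have "\<dots> = (\<Sum>p\<in>{i, j}\<times>{i, j}. \<bar>?d p\<bar>)"
  proof (intro sum.mono_neutral_right ballI)
    show "\<bar>?d p\<bar> = 0" if "p \<in> {..<n} \<times> {..<n} - {i, j} \<times> {i, j}" for p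
    proof -
      obtain k l where p: "p = (k, l)" by fastforce
      with that have kl: "k < n" "l < n" and "k \<noteq> i \<and> k \<noteq> j \<or> l \<noteq> i \<and> l \<noteq> j" by auto
      then have "rot n i j \<alpha> $$ (k, l) = (if k = l then 1 else 0)" for \<alpha>
        by (elim disjE) (simp_all add: rot_def)
      then show ?thesis by (simp add: p)
    qed
  qed (use assms in auto)
  also have "\<dots> \<le> (\<Sum>p\<in>{i, j}\<times>{i, j}. \<bar>\<theta> - \<phi>\<bar>)"
  proof (rule sum_mono)
    fix p assume "p \<in> {i, j} \<times> {i, j}"
    then consider "p = (i, i)" | "p = (i, j)" | "p = (j, i)" | "p = (j, j)" by auto
    then show "\<bar>?d p\<bar> \<le> \<bar>\<theta> - \<phi>\<bar>"
      using assms abs_sin_diff_le[of \<theta> \<phi>] abs_cos_diff_le[of \<theta> \<phi>]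
      by cases (simp_all add: rot_def)
  qed
  also have "\<dots> = 4 * \<bar>\<theta> - \<phi>\<bar>" using assms by (simp add: card_cartesian_product)
  finally show ?thesis .
qed

text \<open>7 is a rational bound above the full turn \<open>2 * pi\<close>, so the \<open>A\<close>
  grid angles come within \<open>7 / A\<close> of every angle of the walk.\<close>

primrec kac_net :: "nat \<Rightarrow> nat \<Rightarrow> nat \<Rightarrow> real mat set" where
  "kac_net n A 0 = {1\<^sub>m n}"
| "kac_net n A (Suc t) = (\<lambda>((i, j), m, y). rot n i j (7 * real m / real A) * y) `
     ({(i, j). i < j \<and> j < n} \<times> {..<A} \<times> kac_net n A t)"

lemma finite_pairs: "finite {(i, j). i < j \<and> j < (n::nat)}"
  by (rule finite_subset[of _ "{..<n} \<times> {..<n}"]) auto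

lemma finite_kac_net: "finite (kac_net n A t)"
  by (induction t) (auto simp: finite_pairs)

lemma kac_net_SO: "kac_net n A t \<subseteq> SO n"
  by (induction t) (auto intro!: SO_mult rot_in_SO one_in_SO)

lemma card_kac_net: "card (kac_net n A t) \<le> ((n choose 2) * A) ^ t"
proof (induction t)
  case (Suc t)
  have "card (kac_net n A (Suc t)) \<le> card ({(i, j). i < j \<and> j < n} \<times> {..<A} \<times> kac_net n A t)"
    unfolding kac_net.simps by (intro card_image_le finite_cartesian_product finite_pairs finite_kac_net) simp
  also have "\<dots> = (n choose 2) * A * card (kac_net n A t)"
    by (simp add: card_cartesian_product card_pairs)
  also have "\<dots> \<le> (n choose 2) * A * ((n choose 2) * A) ^ t"
    using Suc by (intro mult_left_mono) auto
  finally show ?case by simp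
qed simp

lemma kac_kernel_eq_1:
  assumes "n \<ge> 2" "x \<in> SO n"
    and S: "\<And>i j \<theta>. i < j \<Longrightarrow> j < n \<Longrightarrow> 0 \<le> \<theta> \<Longrightarrow> \<theta> \<le> 2 * pi \<Longrightarrow> rot n i j \<theta> * x \<in> S"
  shows "kac_kernel n x S = 1"
proof -
  have "kac_kernel n x S = kac_kernel n x (SO n)"
    unfolding kac_kernel_def
  proof (intro arg_cong2[where f = "(*)"] sum.cong refl, clarify)
    fix i j assume ij: "i < j" "j < n"
    show "(\<integral>\<^sup>+ \<theta>\<in>{0..2 * pi}. indicator S (rot n i j \<theta> * x) \<partial>lborel)
      = (\<integral>\<^sup>+ \<theta>\<in>{0..2 * pi}. indicator (SO n) (rot n i j \<theta> * x) \<partial>lborel)"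
      using S[OF ij] SO_mult[OF rot_in_SO[OF ij] assms(2)]
      by (intro nn_integral_cong) (auto simp: indicator_def)
  qed
  then show ?thesis using kac_kernel_SO[OF assms(1,2)] by simp
qed

text \<open>Rounding the angle down to the grid moves the rotation by at most
  \<open>4 * (7 / A)\<close>, and left multiplication preserves the error \<open>s\<close> of
  \<open>x\<close>.\<close>

lemma rot_mult_in_nbhd:
  assumes A: "A > 0" and x: "x \<in> hs_nbhd n (kac_net n A t) s" and ij: "i < j" "j < n"
    and \<theta>: "0 \<le> \<theta>" "\<theta> \<le> 2 * pi"
  shows "rot n i j \<theta> * x \<in> hs_nbhd n (kac_net n A (Suc t)) (s + 28 / real A)"
proof -
  from x obtain y where y: "y \<in> kac_net n A t" "hs y x < s" and xS: "x \<in> SO n"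
    by (auto simp: hs_nbhd_def)
  have yS: "y \<in> SO n" using y kac_net_SO by blast
  define m where "m = nat \<lfloor>\<theta> * real A / 7\<rfloor>"
  have "0 \<le> \<theta> * real A / 7" using \<theta> by simp
  then have m: "real m \<le> \<theta> * real A / 7" "\<theta> * real A / 7 < real m + 1"
    unfolding m_def by linarith+
  \<comment> \<open>This keeps the grid index strictly below \<open>A\<close>.\<close>
  have "2 * pi < 7" using pi_approx by simp
  then have "\<theta> * real A / 7 < 7 * real A / 7"
    using \<theta> A by (intro divide_strict_right_mono mult_strict_right_mono) auto
  then have "real m < real A" using m by simp
  then have "m < A" by simp
  define \<phi> where "\<phi> = 7 * real m / real A"
  have "\<bar>\<phi> - \<theta>\<bar> \<le> 7 / real A"
  proof -
    have "\<phi> \<le> \<theta>" "\<theta> \<le> \<phi> + 7 / real A"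
      using m A by (simp_all add: \<phi>_def add_divide_distrib[symmetric] pos_divide_le_eq pos_le_divide_eq)
    then show ?thesis by linarith
  qed
  then have close: "hs (rot n i j \<phi>) (rot n i j \<theta>) \<le> 28 / real A"
    using hs_rot_le[OF ij, of \<phi> \<theta>] by simp
  note R = rot_in_SO[OF ij]
  \<comment> \<open>Right invariance handles the first term of the triangle inequality, left
    invariance the second.\<close>
  have "hs (rot n i j \<phi> * y) (rot n i j \<theta> * x)
    \<le> hs (rot n i j \<phi> * y) (rot n i j \<theta> * y) + hs (rot n i j \<theta> * y) (rot n i j \<theta> * x)"
    using xS yS R by (intro hs_triangle[of _ n] SO_carrier SO_mult) auto
  also have "\<dots> = hs (rot n i j \<phi>) (rot n i j \<theta>) + hs y x"
    using xS yS R by (simp add: hs_mult_left[of _ n] hs_mult_right[of _ n] SO_carrier)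
  also have "\<dots> < s + 28 / real A" using close y by simp
  finally have "hs (rot n i j \<phi> * y) (rot n i j \<theta> * x) < s + 28 / real A" .
  moreover have "rot n i j \<phi> * y \<in> kac_net n A (Suc t)"
    using ij \<open>m < A\<close> y unfolding \<phi>_def kac_net.simps by (intro image_eqI[of _ _ "((i, j), m, y)"]) auto
  ultimately show ?thesis
    using SO_mult[OF R xS] by (auto simp: hs_nbhd_def simp del: kac_net.simps)
qed

lemma borel_prob_return:
  assumes "x \<in> SO n"
  shows "borel_prob n (return (SO_borel n) x)"
  using assms by (simp add: borel_prob_def prob_space_return)

text \<open>Each step adds \<open>28 / A\<close> to the radius. The radius starts at
  \<open>28 / A\<close> because the neighbourhoods are open and radius 0 would give the empty
  set.\<close>

lemma kac_walk_near_net: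
  assumes n: "n \<ge> 2" and A: "A > 0"
  shows "emeasure (kac_walk n (return (SO_borel n) (1\<^sub>m n)) t)
    (hs_nbhd n (kac_net n A t) (28 * (real t + 1) / real A)) = 1"
proof (induction t)
  case 0
  have "hs (1\<^sub>m n) (1\<^sub>m n) = 0" using hs_eq_0_iff[of "1\<^sub>m n" n "1\<^sub>m n"] by simp
  then have "1\<^sub>m n \<in> hs_nbhd n (kac_net n A 0) (28 / real A)"
    using A by (simp add: hs_nbhd_def one_in_SO)
  then show ?case
    using sets_hs_nbhd[OF kac_net_SO, of n A 0 "28 / real A"] by (simp add: kac_walk_def)
next
  case (Suc t)
  define \<nu> where "\<nu> = kac_walk n (return (SO_borel n) (1\<^sub>m n)) t"
  define s where "s = 28 * (real t + 1) / real A"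
  have s': "28 * (real (Suc t) + 1) / real A = s + 28 / real A"
    by (simp add: s_def add_divide_distrib algebra_simps)
  let ?B = "hs_nbhd n (kac_net n A t) s"
  let ?B' = "hs_nbhd n (kac_net n A (Suc t)) (s + 28 / real A)"
  have P: "borel_prob n (kac_walk n (return (SO_borel n) (1\<^sub>m n)) u)" for u
    by (intro borel_prob_kac_walk n borel_prob_return one_in_SO)
  have step: "kac_walk n (return (SO_borel n) (1\<^sub>m n)) (Suc t) = kac_step n \<nu>"
    by (simp add: kac_walk_def \<nu>_def)
  have sets\<nu>: "sets \<nu> = sets (SO_borel n)" using P[of t] by (simp add: \<nu>_def borel_prob_def)
  have "1 = emeasure \<nu> ?B" using Suc by (simp add: \<nu>_def s_def)
  also have "\<dots> = (\<integral>\<^sup>+ x. indicator ?B x \<partial>\<nu>)"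
    using sets_hs_nbhd[OF kac_net_SO] by (simp add: sets\<nu>)
  \<comment> \<open>From every point of \<open>?B\<close> the kernel puts mass 1 on
    \<open>?B'\<close>, so it dominates the indicator of \<open>?B\<close>.\<close>
  also have "\<dots> \<le> (\<integral>\<^sup>+ x. kac_kernel n x ?B' \<partial>\<nu>)"
  proof (rule nn_integral_mono)
    fix x
    show "indicator ?B x \<le> kac_kernel n x ?B'"
    proof (cases "x \<in> ?B")
      case True
      then have "x \<in> SO n" by (simp add: hs_nbhd_def)
      then have "kac_kernel n x ?B' = 1"
        by (intro kac_kernel_eq_1 n rot_mult_in_nbhd A True) 
      then show ?thesis by (simp add: indicator_def)
    qed simp
  qed
  also have "\<dots> = emeasure (kac_step n \<nu>) ?B'"
    by (rule emeasure_kac_step[OF sets\<nu> sets_hs_nbhd[OF kac_net_SO], symmetric])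
  finally have "1 \<le> emeasure (kac_step n \<nu>) ?B'" .
  moreover have "prob_space (kac_step n \<nu>)" using P[of "Suc t"] by (simp add: step borel_prob_def)
  then have "emeasure (kac_step n \<nu>) ?B' \<le> 1" by (rule prob_space.measure_le_1)
  ultimately show ?case unfolding step s' by (rule antisym[rotated])
qed

section \<open>From transportation cost to Haar mass near the net\<close>

text \<open>Markov's inequality: under a nearly optimal coupling the two coordinates are within
  \<open>4 \<epsilon>\<close> of each other with probability at least \<open>1/2\<close>.\<close>

lemma W1_small_imp_nbhd:
  assumes \<nu>: "borel_prob n \<nu>" and H: "borel_prob n H" and F: "F \<subseteq> SO n" and \<epsilon>: "\<epsilon> > 0"
    and near: "emeasure \<nu> (hs_nbhd n F s) = 1" and W: "W1 hs \<nu> H \<le> ennreal \<epsilon>"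
  shows "1 / 2 \<le> measure H (hs_nbhd n F (s + 4 * \<epsilon>))"
proof -
  \<comment> \<open>A strict bound is what yields an actual coupling below the infimum; doubling
    \<open>\<epsilon>\<close> provides it.\<close>
  have "W1 hs \<nu> H < ennreal (2 * \<epsilon>)"
    using W \<epsilon> by (elim le_less_trans) (simp add: ennreal_less_iff)
  then obtain \<eta> where \<eta>: "\<eta> \<in> couplings \<nu> H"
    and cost: "(\<integral>\<^sup>+ p. ennreal (hs (fst p) (snd p)) \<partial>\<eta>) < ennreal (2 * \<epsilon>)"
    unfolding W1_def INF_less_iff by blast
  have sets\<eta>: "sets \<eta> = sets (\<nu> \<Otimes>\<^sub>M H)" and d1: "distr \<eta> \<nu> fst = \<nu>" and d2: "distr \<eta> H snd = H"
    and "prob_space \<eta>"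
    using \<eta> by (auto simp: couplings_def)
  interpret \<eta>: prob_space \<eta> by fact
  interpret \<nu>: prob_space \<nu> using \<nu> by (simp add: borel_prob_def)
  have sets: "sets \<nu> = sets (SO_borel n)" "sets H = sets (SO_borel n)"
    using \<nu> H by (simp_all add: borel_prob_def)
  have m [measurable]: "fst \<in> measurable \<eta> \<nu>" "snd \<in> measurable \<eta> H"
    by (simp_all add: measurable_cong_sets[OF sets\<eta> refl])
  have sp: "space \<eta> = SO n \<times> SO n"
    using sets_eq_imp_space_eq[OF sets\<eta>] sets_eq_imp_space_eq[OF sets(1)] sets_eq_imp_space_eq[OF sets(2)]
    by (simp add: space_pair_measure)
  let ?S = "hs_nbhd n F s"
  let ?B = "hs_nbhd n F (s + 4 * \<epsilon>)"
  have B [measurable]: "?B \<in> sets H" "?S \<in> sets \<nu>" using sets_hs_nbhd[OF F] by (simp_all add: sets)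
  have "AE x in \<nu>. x \<in> ?S"
    using near B by (subst \<nu>.AE_in_set_eq_1) (simp_all add: measure_def)
  then have "AE x in distr \<eta> \<nu> fst. x \<in> ?S" by (subst d1)
  then have AE: "AE p in \<eta>. fst p \<in> ?S" by (rule AE_distrD[OF m(1)])
  define C where "C = {p \<in> space \<eta>. snd p \<notin> ?B}"
  have C: "C \<in> sets \<eta>" unfolding C_def by measurable
  have "ennreal (4 * \<epsilon>) * emeasure \<eta> C = (\<integral>\<^sup>+ p. ennreal (4 * \<epsilon>) * indicator C p \<partial>\<eta>)"
    using C by (simp add: nn_integral_cmult_indicator)
  \<comment> \<open>Almost surely on \<open>C\<close> the first coordinate is within
    \<open>s\<close> of \<open>F\<close> while the second is not within
    \<open>s + 4 * \<epsilon>\<close>, so the cost there is at least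
    \<open>4 * \<epsilon>\<close>.\<close>
  also have "\<dots> \<le> (\<integral>\<^sup>+ p. ennreal (hs (fst p) (snd p)) \<partial>\<eta>)"
  proof (rule nn_integral_mono_AE)
    show "AE p in \<eta>. ennreal (4 * \<epsilon>) * indicator C p \<le> ennreal (hs (fst p) (snd p))"
      using AE AE_space
    proof eventually_elim
      case (elim p)
      show ?case
      proof (cases "p \<in> C")
        case True
        from elim(1) obtain y where y: "y \<in> F" "hs y (fst p) < s" unfolding hs_nbhd_def by blast
        have p: "fst p \<in> SO n" "snd p \<in> SO n" using elim(2) unfolding sp by auto
        have "\<not> hs y (snd p) < s + 4 * \<epsilon>" using True y p by (auto simp: C_def hs_nbhd_def)
        moreover have "hs y (snd p) \<le> hs y (fst p) + hs (fst p) (snd p)"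
          using y F p by (intro hs_triangle[of _ n] SO_carrier) auto
        ultimately have "4 * \<epsilon> \<le> hs (fst p) (snd p)" using y by linarith
        then show ?thesis using True by (simp add: ennreal_leI)
      qed simp
    qed
  qed
  also note cost
  finally have "ennreal (4 * \<epsilon> * measure \<eta> C) < ennreal (2 * \<epsilon>)"
    using \<epsilon> by (simp add: \<eta>.emeasure_eq_measure ennreal_mult)
  then have "4 * \<epsilon> * measure \<eta> C < 2 * \<epsilon>" using \<epsilon> by (simp add: ennreal_less_iff)
  then have "measure \<eta> C < 1 / 2" using \<epsilon> by simp
  moreover have "measure H ?B = measure (distr \<eta> H snd) ?B" by (simp add: d2)
  then have "measure H ?B = measure \<eta> (space \<eta> - C)"
    by (subst (asm) measure_distr) (auto simp: C_def intro!: arg_cong[where f = "measure \<eta>"])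
  then have "measure H ?B = 1 - measure \<eta> C" using C by (simp add: \<eta>.prob_compl)
  ultimately show ?thesis by simp
qed

section \<open>Balancing the net against the ball estimate\<close>

text \<open>Each column contributes a factor at most \<open>p\<close>, and \<open>n div 2\<close> is
  at least \<open>N / 3\<close>, which produces \<open>N powr (- (N\<^sup>2 / 24))\<close>. Since
  \<open>42 * 24 = 1008\<close>, the assumption on \<open>t\<close> lets this cancel the net factor,
  and the remaining powers of 2 are small.\<close>

lemma net_times_ball_bound:
  fixes n t L :: nat
  assumes n: "n \<ge> 2" and L: "2 ^ 28 * sqrt (real n) \<le> real L" and t: "1008 * real t < (real n)\<^sup>2"
  shows "(real n ^ 42) ^ t * (2 ^ n * (2 ^ n / real L powr (real n / 4)) ^ (n div 2)) < 1 / 2"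
proof -
  define N where "N = real n"
  have N: "N \<ge> 2" using n by (simp add: N_def)
  define p where "p = 2 powr (- 6 * N) * N powr (- N / 8)"
  have "L > 0" using L n by (auto intro: Nat.gr0I)
  \<comment> \<open>Raised to the power \<open>N / 4\<close>, the constant \<open>2 ^ 28\<close>
    becomes \<open>2 powr (7 * N)\<close>; after absorbing \<open>2 ^ n\<close> it leaves
    \<open>2 powr (- 6 * N)\<close>.\<close>
  have "2 powr (7 * N) * N powr (N / 8) = (2 ^ 28 * sqrt N) powr (N / 4)"
  proof -
    have "(2 ^ 28 * sqrt N) powr (N / 4) = (2 powr 28 * N powr (1 / 2)) powr (N / 4)"
      using N by (simp add: powr_half_sqrt flip: powr_numeral)
    also have "\<dots> = 2 powr (7 * N) * N powr (N / 8)"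
      using N by (subst powr_mult) (unfold powr_powr, simp_all)
    finally show ?thesis by simp
  qed
  also have "\<dots> \<le> real L powr (N / 4)"
    using L N by (intro powr_mono2) (auto simp: N_def)
  finally have "2 powr N / real L powr (N / 4) \<le> 2 powr N / (2 powr (7 * N) * N powr (N / 8))"
    using N by (intro divide_left_mono mult_pos_pos) (auto simp: \<open>L > 0\<close>)
  also have "\<dots> = p"
    using N by (simp add: p_def powr_minus powr_diff field_simps flip: powr_add)
  finally have q: "2 ^ n / real L powr (real n / 4) \<le> p" by (simp add: N_def powr_realpow)
  \<comment> \<open>With \<open>p \<le> 1\<close>, lowering the exponent from \<open>n div 2\<close>
    to \<open>N / 3\<close> can only increase the power.\<close>
  have "2 powr (- 6 * N) \<le> 2 powr 0" "N powr (- N / 8) \<le> N powr 0"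
    using N by (intro powr_mono; simp)+
  then have p: "0 < p" "p \<le> 1" using N by (auto simp: p_def mult_le_one)
  \<comment> \<open>Rounding is worst at \<open>n = 3\<close>, where equality holds.\<close>
  have "n \<le> 3 * (n div 2)" using n by linarith
  then have div: "N / 3 \<le> real (n div 2)" unfolding N_def by linarith
  have "(2 ^ n / real L powr (real n / 4)) ^ (n div 2) \<le> p ^ (n div 2)"
    using q by (intro power_mono) auto
  also have "\<dots> = p powr real (n div 2)" using p by (simp add: powr_realpow)
  also have "\<dots> \<le> p powr (N / 3)" using p div by (intro powr_mono') auto
  also have "\<dots> = 2 powr (- 2 * N\<^sup>2) * N powr (- (N\<^sup>2 / 24))"
    using N by (simp add: p_def powr_mult powr_powr power2_eq_square)
  finally have ball: "(2 ^ n / real L powr (real n / 4)) ^ (n div 2) \<le> 2 powr (- 2 * N\<^sup>2) * N powr (- (N\<^sup>2 / 24))" .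
  have "(real n ^ 42) ^ t = N powr (42 * real t)"
  proof -
    have "(real n ^ 42) ^ t = N ^ (42 * t)" by (simp only: N_def power_mult)
    also have "\<dots> = N powr real (42 * t)" using N by (intro powr_realpow[symmetric]) simp
    finally show ?thesis by simp
  qed
  also have "\<dots> \<le> N powr (N\<^sup>2 / 24)" using N t by (intro powr_mono) (auto simp: N_def)
  finally have "(real n ^ 42) ^ t * (2 ^ n * (2 ^ n / real L powr (real n / 4)) ^ (n div 2))
    \<le> N powr (N\<^sup>2 / 24) * (2 ^ n * (2 powr (- 2 * N\<^sup>2) * N powr (- (N\<^sup>2 / 24))))"
    using ball by (intro mult_mono mult_left_mono) auto
  also have "\<dots> = (N powr (N\<^sup>2 / 24) * N powr (- (N\<^sup>2 / 24))) * (2 powr N * 2 powr (- 2 * N\<^sup>2))"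
    by (simp add: N_def powr_realpow mult_ac)
  also have "\<dots> = 2 powr (N - 2 * N\<^sup>2)"
    using N by (simp flip: powr_add)
  also have "\<dots> < 2 powr (- 1)"
  proof (rule powr_less_mono)
    have "N * 2 \<le> N * N" using N by (intro mult_left_mono) auto
    then show "N - 2 * N\<^sup>2 < - 1" using N unfolding power2_eq_square by linarith
  qed simp
  also have "\<dots> = 1 / 2" by (simp add: powr_minus)
  finally show ?thesis .
qed

text \<open>A small cost would put half of the Haar mass into balls of radius \<open>\<rho>\<close>
  around the net, whose total mass is below \<open>1 / 2\<close>.\<close>

lemma W1_kac_walk_gt:
  assumes H: "is_haar n H" and n: "n \<ge> 2" and t: "1008 * real t < (real n)\<^sup>2"
  shows "W1 hs (kac_walk n (return (SO_borel n) (1\<^sub>m n)) t) H > ennreal (1 / 2 ^ 35)"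
proof (rule ccontr)
  assume "\<not> ?thesis"
  then have W: "W1 hs (kac_walk n (return (SO_borel n) (1\<^sub>m n)) t) H \<le> ennreal (1 / 2 ^ 35)"
    by (simp only: not_less)
  interpret prob_space H by (rule is_haarD[OF H])
  note setsH = is_haarD(2)[OF H]
  \<comment> \<open>\<open>A\<close> makes the discretisation error \<open>s\<close> at most
    \<open>1 / 2 ^ 33\<close>. The coupling radius \<open>4 / 2 ^ 35\<close> has the same size, and
    together they give \<open>\<rho>\<close>.\<close>
  define A where "A = 28 * n\<^sup>2 * 2 ^ 33"
  define F where "F = kac_net n A t"
  define s where "s = 28 * (real t + 1) / real A"
  define \<rho> where "\<rho> = (1 / 2 ^ 32 :: real)"
  \<comment> \<open>\<open>c\<close> is the least alphabet size that
    \<open>net_times_ball_bound\<close> accepts. Rounding up at most doubles it, so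
    \<open>32 * \<rho>\<^sup>2 * (real L)\<^sup>2\<close> is at most \<open>n / 2\<close>, within
    the bound of \<open>haar_ball_le\<close>.\<close>
  define c where "c = 2 ^ 28 * sqrt (real n)"
  define L where "L = nat \<lceil>c\<rceil>"
  have A: "A > 0" using n by (simp add: A_def)
  have F: "F \<subseteq> SO n" "finite F" by (simp_all add: F_def kac_net_SO finite_kac_net)
  have "real t < real (n\<^sup>2)" unfolding of_nat_power using t by linarith
  then have "t + 1 \<le> n\<^sup>2" by (simp only: of_nat_less_iff)
  then have "real (t + 1) \<le> real (n\<^sup>2)" by (rule of_nat_mono)
  then have "real t + 1 \<le> (real n)\<^sup>2" by simp
  then have "s \<le> 28 * (real n)\<^sup>2 / real A" unfolding s_def by (intro divide_right_mono) auto
  also have "\<dots> = 1 / 2 ^ 33" using n by (simp add: A_def)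
  finally have s: "s + 4 * (1 / 2 ^ 35) \<le> \<rho>" by (simp add: \<rho>_def)
  have "1 / 2 \<le> measure H (hs_nbhd n F (s + 4 * (1 / 2 ^ 35)))"
  proof (rule W1_small_imp_nbhd[OF _ _ F(1) _ _ W])
    show "borel_prob n (kac_walk n (return (SO_borel n) (1\<^sub>m n)) t)"
      by (intro borel_prob_kac_walk n borel_prob_return one_in_SO)
    show "borel_prob n H" using H by (simp add: is_haar_def)
    show "emeasure (kac_walk n (return (SO_borel n) (1\<^sub>m n)) t) (hs_nbhd n F s) = 1"
      unfolding F_def s_def by (rule kac_walk_near_net[OF n A])
  qed simp
  also have "\<dots> \<le> measure H (\<Union>y\<in>F. hs_nbhd n {y} \<rho>)"
  proof (rule finite_measure_mono)
    show "hs_nbhd n F (s + 4 * (1 / 2 ^ 35)) \<subseteq> (\<Union>y\<in>F. hs_nbhd n {y} \<rho>)"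
      using s by (force simp: hs_nbhd_def)
    show "(\<Union>y\<in>F. hs_nbhd n {y} \<rho>) \<in> sets H"
      using F by (intro sets.finite_UN) (auto simp: setsH intro!: sets_hs_nbhd)
  qed
  also have "\<dots> \<le> (\<Sum>y\<in>F. measure H (hs_nbhd n {y} \<rho>))"
    using F by (intro finite_measure_subadditive_finite) (auto simp: setsH intro!: sets_hs_nbhd)
  also have "\<dots> \<le> (\<Sum>y\<in>F. 2 ^ n * (2 ^ n / real L powr (real n / 4)) ^ (n div 2))"
  proof (rule sum_mono)
    fix y assume "y \<in> F"
    have "1 \<le> sqrt (real n)" using n by simp
    then have c: "1 \<le> c" unfolding c_def by (rule order_trans) simp
    then have "real L = of_int \<lceil>c\<rceil>" by (simp add: L_def)
    with c have "real L \<le> 2 * c" and "L > 0" by linarith+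
    then have "real L \<le> 2 ^ 29 * sqrt (real n)" by (simp add: c_def)
    then have "(real L)\<^sup>2 \<le> (2 ^ 29 * sqrt (real n))\<^sup>2" by (intro power_mono) auto
    then have "32 * \<rho>\<^sup>2 * (real L)\<^sup>2 \<le> 32 * \<rho>\<^sup>2 * (2 ^ 58 * real n)"
      by (intro mult_left_mono) (auto simp: power_mult_distrib)
    also have "\<dots> \<le> real n" by (simp add: \<rho>_def power_divide)
    finally have "measure H {a \<in> SO n. hs y a < \<rho>} \<le> 2 ^ n * (2 ^ n / real L powr (real n / 4)) ^ (n div 2)"
      using n F \<open>y \<in> F\<close> \<open>L > 0\<close> by (intro haar_ball_le[OF H]) auto
    then show "measure H (hs_nbhd n {y} \<rho>) \<le> 2 ^ n * (2 ^ n / real L powr (real n / 4)) ^ (n div 2)"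
      by (simp add: hs_nbhd_def)
  qed
  also have "\<dots> = real (card F) * (2 ^ n * (2 ^ n / real L powr (real n / 4)) ^ (n div 2))" by simp
  also have "\<dots> \<le> (real n ^ 42) ^ t * (2 ^ n * (2 ^ n / real L powr (real n / 4)) ^ (n div 2))"
  proof (rule mult_right_mono)
    \<comment> \<open>\<open>28 * 2 ^ 33\<close> is below \<open>2 ^ 38\<close>, which
      \<open>n \<ge> 2\<close> turns into \<open>n ^ 38\<close>; the net thus grows by at most
      \<open>n ^ 42\<close> per step.\<close>
    have "(n choose 2) * A \<le> n\<^sup>2 * (2 ^ 38 * n\<^sup>2)"
      using binomial_le_pow[of 2 n] n by (intro mult_mono) (auto simp: A_def)
    also have "\<dots> \<le> n\<^sup>2 * (n ^ 38 * n\<^sup>2)"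
      using n by (intro mult_mono power_mono) auto
    also have "\<dots> = n ^ 42" by (simp flip: power_add)
    finally have "((n choose 2) * A) ^ t \<le> (n ^ 42) ^ t" by (rule power_mono) simp
    then have "card F \<le> (n ^ 42) ^ t" unfolding F_def by (rule order_trans[OF card_kac_net])
    then have "real (card F) \<le> real ((n ^ 42) ^ t)" by (rule of_nat_mono)
    then show "real (card F) \<le> (real n ^ 42) ^ t" by simp
  qed simp
  also have "\<dots> < 1 / 2"
    by (rule net_times_ball_bound[OF n _ t]) (simp add: L_def c_def)
  finally show False by simp
qed

theorem theorem2:
  shows "\<exists>c>0. \<exists>\<epsilon>\<^sub>0>0. \<forall>n\<ge>2. \<forall>H. is_haar n H \<longrightarrow>
    ereal (c * real n ^ 2) \<le> ereal_of_enat (mixing_time n H \<epsilon>\<^sub>0)"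
proof (intro exI conjI allI impI)
  show "(1 / 1008 :: real) > 0" "(1 / 2 ^ 35 :: real) > 0" by simp_all
  fix n :: nat and H assume n: "n \<ge> 2" and H: "is_haar n H"
  \<comment> \<open>The least integer time not excluded by \<open>W1_kac_walk_gt\<close>.\<close>
  define T where "T = nat \<lceil>1 / 1008 * (real n)\<^sup>2\<rceil>"
  have "enat T \<le> mixing_time n H (1 / 2 ^ 35)"
    unfolding mixing_time_def
  \<comment> \<open>If no time qualifies, the infimum is \<open>\<infinity>\<close> and the bound
    holds as well.\<close>
  proof (rule Inf_greatest)
    fix x assume "x \<in> {enat t |t. \<forall>\<mu>. borel_prob n \<mu> \<longrightarrow> W1 hs (kac_walk n \<mu> t) H \<le> ennreal (1 / 2 ^ 35)}"
    then obtain t where x: "x = enat t"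
      and t: "\<And>\<mu>. borel_prob n \<mu> \<Longrightarrow> W1 hs (kac_walk n \<mu> t) H \<le> ennreal (1 / 2 ^ 35)" by blast
    \<comment> \<open>The condition on all starting measures is tested on the point mass at the
      identity.\<close>
    have "\<not> 1008 * real t < (real n)\<^sup>2"
      using W1_kac_walk_gt[OF H n] t[OF borel_prob_return[OF one_in_SO]] by (meson not_less)
    then have "T \<le> t" unfolding T_def by (simp add: nat_le_iff ceiling_le_iff)
    then show "enat T \<le> x" by (simp add: x)
  qed
  then have "ereal_of_enat (enat T) \<le> ereal_of_enat (mixing_time n H (1 / 2 ^ 35))"
    by (simp only: ereal_of_enat_le_iff)
  moreover have "ereal (1 / 1008 * real n ^ 2) \<le> ereal_of_enat (enat T)"
    unfolding T_def by (simp add: real_nat_ceiling_ge)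
  ultimately show "ereal (1 / 1008 * real n ^ 2) \<le> ereal_of_enat (mixing_time n H (1 / 2 ^ 35))"
    by (rule order_trans[rotated])
qed

end
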